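(* Let $(E,B,p,\Gamma)$ be a compact graph bundle, let $F:E\to E$ and $f:B\to B$ be continuous with $p\circ F=f\circ p$, and assume $(B,f)$ is minimal. Let $M$ be a minimal set of $F$ with $p(M)=B$, and assume $M$ is nowhere dense in $E$. Then either (E1) there is a residual set $R\subseteq B$ such that $M_b$ is a Cantor set for every $b\in R$, or (E2) there are a positive integer $N$ and a residual set $R\subseteq B$ such that $M_b$ has exactly $N$ points for every $b\in R$.
   Context: A graph is a nonempty compact metric space that is a union of finitely many arcs pairwise disjoint or meeting only at end-points. A compact graph bundle $(E,B,p,\Gamma)$: $E,B$ compact metric spaces, $\Gamma$ a graph, $p:E\to B$ a continuous surjection such that every $b\in B$ has an open neighbourhood $U$ and a homeomorphism $h:p^{-1}(U)\to U\times\Gamma$ with $\mathrm{pr}_1\circ h=p$. For $M\subseteq E$, $M_b=M\cap p^{-1}(b)$. A continuous selfmap of a compact metric space is minimal if it has no proper nonempty closed invariant subset; a minimal set of $F$ is a nonempty closed $F$-invariant set on which $F$ is minimal. A set is residual if its complement is a countable union of nowhere dense sets. *)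

theory Defs
  imports "HOL-Analysis.Analysis"
begin

definition is_graph :: "'g::metric_space set \<Rightarrow> bool" where
  "is_graph \<Gamma> \<longleftrightarrow> \<Gamma> \<noteq> {} \<and> compact \<Gamma> \<and>
     (\<exists>gs :: (real \<Rightarrow> 'g) list.
        (\<forall>g\<in>set gs. arc g) \<and>
        \<Gamma> = (\<Union>g\<in>set gs. path_image g) \<and>
        (\<forall>i<length gs. \<forall>j<length gs. i \<noteq> j \<longrightarrow>
            path_image (gs!i) \<inter> path_image (gs!j)
              \<subseteq> {pathstart (gs!i), pathfinish (gs!i)} \<inter> {pathstart (gs!j), pathfinish (gs!j)}))"

definition compact_graph_bundle ::
  "'e::metric_space set \<Rightarrow> 'b::metric_space set \<Rightarrow> ('e \<Rightarrow> 'b) \<Rightarrow> 'g::metric_space set \<Rightarrow> bool" where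
  "compact_graph_bundle E B p \<Gamma> \<longleftrightarrow>
     compact E \<and> compact B \<and> is_graph \<Gamma> \<and>
     continuous_on E p \<and> p ` E = B \<and>
     (\<forall>b\<in>B. \<exists>U. openin (top_of_set B) U \<and> b \<in> U \<and>
        (\<exists>h k. homeomorphism (E \<inter> p -` U) (U \<times> \<Gamma>) h k \<and>
               (\<forall>x\<in>E \<inter> p -` U. fst (h x) = p x)))"

definition minimal_map :: "'a::metric_space set \<Rightarrow> ('a \<Rightarrow> 'a) \<Rightarrow> bool" where
  "minimal_map X f \<longleftrightarrow> f ` X \<subseteq> X \<and>
     (\<forall>A. A \<subseteq> X \<and> closedin (top_of_set X) A \<and> A \<noteq> {} \<and> f ` A \<subseteq> A \<longrightarrow> A = X)"

definition minimal_set :: "'a::metric_space set \<Rightarrow> ('a \<Rightarrow> 'a) \<Rightarrow> 'a set \<Rightarrow> bool" where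
  "minimal_set E F M \<longleftrightarrow> M \<noteq> {} \<and> M \<subseteq> E \<and> closedin (top_of_set E) M \<and> F ` M \<subseteq> M \<and>
     minimal_map M F"

definition nowhere_dense_in :: "'a topology \<Rightarrow> 'a set \<Rightarrow> bool" where
  "nowhere_dense_in X S \<longleftrightarrow> X interior_of (X closure_of S) = {}"

definition residual_in :: "'a topology \<Rightarrow> 'a set \<Rightarrow> bool" where
  "residual_in X R \<longleftrightarrow> R \<subseteq> topspace X \<and>
     (\<exists>C. countable C \<and> (\<forall>S\<in>C. nowhere_dense_in X S) \<and> topspace X - R = \<Union>C)"

definition cantor_ternary :: "real set" where
  "cantor_ternary = {x. \<exists>d::nat \<Rightarrow> real. (\<forall>n. d n \<in> {0, 2}) \<and> (\<lambda>n. d n / 3 ^ Suc n) sums x}"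

definition cantor_set :: "'a::topological_space set \<Rightarrow> bool" where
  "cantor_set S \<longleftrightarrow> S homeomorphic cantor_ternary"

definition fibre :: "('e \<Rightarrow> 'b) \<Rightarrow> 'e set \<Rightarrow> 'b \<Rightarrow> 'e set" where
  "fibre p M b = M \<inter> p -` {b}"

end

theory Submission
  imports Defs
begin

text \<open>
  A minimal map of a compact metric space is irreducible, hence feebly open, and generically it and all its
  iterates have singleton point preimages; by Baire the factor map \<open>p : M \<rightarrow> B\<close> is feebly open as well.

  Since \<open>M\<close> is nowhere dense, the generic fibre has empty interior in the graph and so is totally
  disconnected. If the generic fibre has no isolated points, it is a Cantor set. Otherwise there is a nonempty
  open \<open>O \<subseteq> M\<close> meeting the generic fibre in at most one point, and generically that point has a single
  preimage under each iterate of \<open>F\<close>. As \<open>M\<close> is covered by \<open>F\<^sup>-\<^sup>i(O)\<close>, \<open>i < n\<close>, the generic fibre has at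
  most \<open>n\<close> points. Upper semicontinuity of the fibres and minimality of \<open>f\<close> make the generic cardinality constant.
\<close>

subsection \<open>Residual sets\<close>

text \<open>The obstacle is that neither \<open>F\<close> nor \<open>f\<close> need be injective or
  open: the fibre over \<open>f b\<close> contains the \<open>F\<close>-image of the fibre over
  \<open>b\<close> but may be larger, and distinct points of a fibre may merge. Irreducibility
  repairs both defects generically. Single preimages under \<open>f ^^ i\<close> make the fibre over
  the image point an image of the original fibre; single preimages under \<open>F ^^ i\<close>
  prevent merging. Feeble openness serves to move genericity between spaces: along
  \<open>f ^^ i\<close> within \<open>B\<close>, and from \<open>M\<close> down to \<open>B\<close>
  along \<open>p\<close>. The descent is delicate, since a residual subset of \<open>M\<close> need
  not contain a single whole fibre. It works inside the small open piece because a generic fibre has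
  at most one point there. The bound by the number of visiting times then follows:
  \<open>F ^^ i\<close> sends a fibre into one fibre, so two of its points that enter the piece at
  the same time land on the same point and must coincide. The graph enters through cutting: points
  outside \<open>M\<close> are generically dense in every arc, and two of them on either side of a
  point cut out a relatively clopen piece of the fibre.\<close>

definition dense_interior_in :: "'a topology \<Rightarrow> 'a set \<Rightarrow> bool" where
  "dense_interior_in T G \<longleftrightarrow> (\<forall>W. openin T W \<and> W \<noteq> {} \<longrightarrow>
     (\<exists>V. openin T V \<and> V \<noteq> {} \<and> V \<subseteq> W \<and> V \<subseteq> G))"

lemma dense_interior_inI:
  assumes "\<And>W. openin T W \<Longrightarrow> W \<noteq> {} \<Longrightarrow> \<exists>V. openin T V \<and> V \<noteq> {} \<and> V \<subseteq> W \<and> V \<subseteq> G"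
  shows "dense_interior_in T G"
  using assms by (auto simp: dense_interior_in_def)

lemma dense_interior_inE:
  assumes "dense_interior_in T G" "openin T W" "W \<noteq> {}"
  obtains V where "openin T V" "V \<noteq> {}" "V \<subseteq> W" "V \<subseteq> G"
  using assms unfolding dense_interior_in_def by blast

text \<open>\<open>dense_interior_in T G\<close> expresses that the interior of \<open>G\<close> is
  dense. In its local form, a witness \<open>V\<close> inside each \<open>W\<close>, it is what the
  Baire arguments below can supply directly.\<close>

lemma nowhere_dense_in_iff_dense_interior_in:
  "nowhere_dense_in T S \<longleftrightarrow> dense_interior_in T (topspace T - S)"
proof
  assume nd: "nowhere_dense_in T S"
  show "dense_interior_in T (topspace T - S)"
  proof (rule dense_interior_inI)
    fix W assume W: "openin T W" "W \<noteq> {}"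
    let ?V = "W - T closure_of S"
    have "openin T ?V" using W by (simp add: openin_diff)
    moreover have "?V \<noteq> {}"
    proof
      assume "?V = {}"
      then have "W \<subseteq> T interior_of (T closure_of S)"
        using W by (simp add: interior_of_maximal)
      with nd W show False by (auto simp: nowhere_dense_in_def)
    qed
    moreover have "?V \<subseteq> topspace T - S"
      using openin_subset[OF W(1)] closure_of_subset_Int[of T S] by blast
    ultimately show "\<exists>V. openin T V \<and> V \<noteq> {} \<and> V \<subseteq> W \<and> V \<subseteq> topspace T - S"
      by (intro exI[of _ ?V]) auto
  qed
next
  assume d: "dense_interior_in T (topspace T - S)"
  show "nowhere_dense_in T S"
    unfolding nowhere_dense_in_def
  proof (rule ccontr)
    assume "T interior_of (T closure_of S) \<noteq> {}"
    then obtain V where V: "openin T V" "V \<noteq> {}"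
      "V \<subseteq> T interior_of (T closure_of S)" "V \<subseteq> topspace T - S"
      by (rule dense_interior_inE[OF d openin_interior_of])
    have "V \<subseteq> T closure_of S"
      by (rule order_trans[OF V(3) interior_of_subset])
    moreover have "V \<inter> T closure_of S = {}"
      using V(4) openin_Int_closure_of_eq_empty[OF V(1)] by blast
    ultimately show False
      using V(2) by blast
  qed
qed

text \<open>The dual description is easier to verify: it asks for an inclusion, whereas
  \<open>residual_in\<close> wants a union of nowhere dense sets that equals the complement
  exactly.\<close>

lemma residual_in_iff_dense_interiors:
  "residual_in T R \<longleftrightarrow> R \<subseteq> topspace T \<and>
     (\<exists>G::nat \<Rightarrow> 'a set. (\<forall>n. dense_interior_in T (G n)) \<and> topspace T \<inter> (\<Inter>n. G n) \<subseteq> R)"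
  for T :: "'a topology"
proof
  assume r: "residual_in T R"
  then obtain C where C: "countable C" "\<And>S. S \<in> C \<Longrightarrow> nowhere_dense_in T S" "topspace T - R = \<Union>C"
    and R: "R \<subseteq> topspace T"
    by (auto simp: residual_in_def)
  \<comment> \<open>\<open>C\<close> may be empty, and \<open>from_nat_into\<close> enumerates only
    nonempty sets; the empty set is a harmless nowhere dense member.\<close>
  have *: "countable (insert {} C)" "insert {} C \<noteq> {}"
    using C by auto
  define G where "G n = topspace T - from_nat_into (insert {} C) n" for n
  have "dense_interior_in T (G n)" for n
  proof -
    have "from_nat_into (insert {} C) n \<in> insert {} C"
      using *(2) by (rule from_nat_into)
    moreover have "nowhere_dense_in T {}"
      by (simp add: nowhere_dense_in_def)
    ultimately have "nowhere_dense_in T (from_nat_into (insert {} C) n)"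
      using C(2) by auto
    then show ?thesis
      by (simp add: G_def nowhere_dense_in_iff_dense_interior_in)
  qed
  moreover have "topspace T \<inter> (\<Inter>n. G n) \<subseteq> R"
  proof
    fix x assume x: "x \<in> topspace T \<inter> (\<Inter>n. G n)"
    show "x \<in> R"
    proof (rule ccontr)
      assume "x \<notin> R"
      then obtain S where S: "S \<in> C" "x \<in> S"
        using x C(3) by auto
      then obtain n where "from_nat_into (insert {} C) n = S"
        using * from_nat_into_surj by (metis insertI2)
      with x S show False by (auto simp: G_def)
    qed
  qed
  ultimately show "R \<subseteq> topspace T \<and>
     (\<exists>G::nat \<Rightarrow> 'a set. (\<forall>n. dense_interior_in T (G n)) \<and> topspace T \<inter> (\<Inter>n. G n) \<subseteq> R)"
    using R by blast
next
  assume "R \<subseteq> topspace T \<and>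
     (\<exists>G::nat \<Rightarrow> 'a set. (\<forall>n. dense_interior_in T (G n)) \<and> topspace T \<inter> (\<Inter>n. G n) \<subseteq> R)"
  then obtain G :: "nat \<Rightarrow> 'a set" where R: "R \<subseteq> topspace T"
    and G: "\<And>n. dense_interior_in T (G n)" "topspace T \<inter> (\<Inter>n. G n) \<subseteq> R"
    by blast
  \<comment> \<open>Adding \<open>R\<close> to each \<open>G n\<close> shrinks the removed sets
    until their union is the complement of \<open>R\<close> and nothing more.\<close>
  define C where "C = range (\<lambda>n. topspace T - (G n \<union> R))"
  have "countable C" by (simp add: C_def)
  moreover have "nowhere_dense_in T S" if "S \<in> C" for S
  proof -
    from that obtain n where S: "S = topspace T - (G n \<union> R)" by (auto simp: C_def)
    show ?thesis
      unfolding nowhere_dense_in_iff_dense_interior_in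
    proof (rule dense_interior_inI)
      fix W assume W: "openin T W" "W \<noteq> {}"
      then obtain V where "openin T V" "V \<noteq> {}" "V \<subseteq> W" "V \<subseteq> G n"
        using G(1) dense_interior_inE by metis
      then show "\<exists>V. openin T V \<and> V \<noteq> {} \<and> V \<subseteq> W \<and> V \<subseteq> topspace T - S"
        using openin_subset[of T V] by (intro exI[of _ V]) (auto simp: S)
    qed
  qed
  moreover have "topspace T - R = \<Union>C"
    using G(2) R unfolding C_def by auto
  ultimately show "residual_in T R"
    using R unfolding residual_in_def by blast
qed

lemma residual_inI:
  fixes G :: "nat \<Rightarrow> 'a set"
  assumes "R \<subseteq> topspace T" "\<And>n. dense_interior_in T (G n)"
    "\<And>x. x \<in> topspace T \<Longrightarrow> (\<And>n. x \<in> G n) \<Longrightarrow> x \<in> R"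
  shows "residual_in T R"
  unfolding residual_in_iff_dense_interiors using assms by (intro conjI exI[of _ G]) auto

lemma residual_in_mono:
  "residual_in T R \<Longrightarrow> R \<subseteq> R' \<Longrightarrow> R' \<subseteq> topspace T \<Longrightarrow> residual_in T R'"
  unfolding residual_in_iff_dense_interiors by (meson order_trans)

lemma dense_interior_in_imp_residual_in:
  "dense_interior_in T G \<Longrightarrow> G \<subseteq> topspace T \<Longrightarrow> residual_in T G"
  by (rule residual_inI[where G="\<lambda>_. G"]) auto

lemma residual_in_INT:
  fixes R :: "nat \<Rightarrow> 'a set"
  assumes "\<And>n. residual_in T (R n)"
  shows "residual_in T (\<Inter>n. R n)"
proof -
  obtain G :: "nat \<Rightarrow> nat \<Rightarrow> 'a set" where G: "\<And>n m. dense_interior_in T (G n m)"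
    "\<And>n. topspace T \<inter> (\<Inter>m. G n m) \<subseteq> R n"
    using assms unfolding residual_in_iff_dense_interiors by metis
  have "(\<Inter>n. R n) \<subseteq> topspace T"
    using assms unfolding residual_in_def by blast
  then show ?thesis
  proof (rule residual_inI[where G="\<lambda>k. case prod_decode k of (n, m) \<Rightarrow> G n m"])
    show "dense_interior_in T (case prod_decode k of (n, m) \<Rightarrow> G n m)" for k
      using G(1) by (auto split: prod.split)
    fix x assume x: "x \<in> topspace T" "\<And>k. x \<in> (case prod_decode k of (n, m) \<Rightarrow> G n m)"
    have "x \<in> G n m" for n m
      using x(2)[of "prod_encode (n, m)"] by simp
    then show "x \<in> (\<Inter>n. R n)"
      using G(2) x(1) by blast
  qed
qed

lemma residual_in_Int:
  assumes "residual_in T R" "residual_in T S"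
  shows "residual_in T (R \<inter> S)"
proof -
  have "residual_in T (\<Inter>n::nat. if n = 0 then R else S)"
    by (rule residual_in_INT) (use assms in auto)
  moreover have "(\<Inter>n::nat. if n = 0 then R else S) = R \<inter> S"
    by (auto split: if_splits)
  ultimately show ?thesis by simp
qed

text \<open>The factor \<open>topspace T\<close> takes care of an empty \<open>I\<close>, where the
  intersection is the whole type.\<close>

lemma residual_in_INT_countable:
  assumes "countable I" "\<And>i. i \<in> I \<Longrightarrow> residual_in T (R i)"
  shows "residual_in T (topspace T \<inter> (\<Inter>i\<in>I. R i))"
proof (cases "I = {}")
  case True
  have "dense_interior_in T (topspace T)"
    by (rule dense_interior_inI) (use openin_subset in blast)
  then show ?thesis
    using True by (simp add: dense_interior_in_imp_residual_in)
next
  case False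
  have "residual_in T (\<Inter>n. R (from_nat_into I n))"
    using assms(2) from_nat_into[OF False] by (intro residual_in_INT) auto
  moreover have "(\<Inter>n. R (from_nat_into I n)) = (\<Inter>i\<in>I. R i)"
    by (metis False assms(1) image_image range_from_nat_into)
  moreover have "(\<Inter>i\<in>I. R i) \<subseteq> topspace T"
    using False assms(2) unfolding residual_in_def by blast
  ultimately show ?thesis
    by (simp add: Int_absorb1)
qed

text \<open>Baire: if \<open>R\<close> missed \<open>W\<close>, countably many closed nowhere dense
  sets would cover \<open>W\<close>.\<close>

lemma residual_in_compact_meets_open:
  fixes B :: "'b::metric_space set"
  assumes "compact B" "residual_in (top_of_set B) R" "openin (top_of_set B) W" "W \<noteq> {}"
  shows "R \<inter> W \<noteq> {}"
proof
  assume e: "R \<inter> W = {}"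
  let ?T = "top_of_set B"
  obtain C where C: "countable C" "\<And>S. S \<in> C \<Longrightarrow> nowhere_dense_in ?T S" "topspace ?T - R = \<Union>C"
    using assms(2) by (auto simp: residual_in_def)
  have "?T interior_of \<Union>((closure_of) ?T ` C) = {}"
  proof (rule Baire_category_alt)
    show "completely_metrizable_space ?T \<or> locally_compact_space ?T \<and> regular_space ?T"
      using assms(1) by (simp add: compact_imp_locally_compact_space compact_space_subtopology
          metrizable_imp_regular_space metrizable_space_euclidean metrizable_space_subtopology)
  qed (use C in \<open>auto simp: nowhere_dense_in_def\<close>)
  moreover have "W \<subseteq> \<Union>((closure_of) ?T ` C)"
  proof
    fix x assume x: "x \<in> W"
    then have "x \<in> topspace ?T - R"
      using e openin_subset[OF assms(3)] by auto
    then obtain S where "S \<in> C" "x \<in> S"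
      using C(3) by auto
    moreover have "S \<subseteq> topspace ?T"
      using C(3) \<open>S \<in> C\<close> by blast
    ultimately show "x \<in> \<Union>((closure_of) ?T ` C)"
      using closure_of_subset[of S ?T] by blast
  qed
  ultimately show False
    using assms(4) interior_of_maximal[OF _ assms(3)] by blast
qed

section \<open>Feebly open maps and preimages of residual sets\<close>

definition feebly_open :: "'a topology \<Rightarrow> 'b topology \<Rightarrow> ('a \<Rightarrow> 'b) \<Rightarrow> bool" where
  "feebly_open S T g \<longleftrightarrow> (\<forall>U. openin S U \<and> U \<noteq> {} \<longrightarrow> (\<exists>V. openin T V \<and> V \<noteq> {} \<and> V \<subseteq> g ` U))"

text \<open>The image of \<open>W\<close> contains an open \<open>Z\<close>, and \<open>Z\<close>
  contains an open \<open>V\<close> inside \<open>G n\<close>. As \<open>V\<close> lies in the image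
  of \<open>W\<close>, its preimage meets \<open>W\<close>.\<close>

lemma residual_in_feebly_open_preimage:
  assumes g: "continuous_map S T g" "feebly_open S T g" and R: "residual_in T R"
  shows "residual_in S {x \<in> topspace S. g x \<in> R}"
proof -
  obtain G :: "nat \<Rightarrow> _ set" where G: "\<And>n. dense_interior_in T (G n)" "topspace T \<inter> (\<Inter>n. G n) \<subseteq> R"
    using R unfolding residual_in_iff_dense_interiors by blast
  show ?thesis
  proof (rule residual_inI[where G="\<lambda>n. g -` G n"])
    fix n
    show "dense_interior_in S (g -` G n)"
    proof (rule dense_interior_inI)
      fix W assume W: "openin S W" "W \<noteq> {}"
      then obtain Z where Z: "openin T Z" "Z \<noteq> {}" "Z \<subseteq> g ` W"
        using g(2) unfolding feebly_open_def by blast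
      then obtain V where V: "openin T V" "V \<noteq> {}" "V \<subseteq> Z" "V \<subseteq> G n"
        using G(1) dense_interior_inE by metis
      have "openin S (W \<inter> {x \<in> topspace S. g x \<in> V})"
        using W V g(1) openin_continuous_map_preimage by blast
      moreover have "W \<inter> {x \<in> topspace S. g x \<in> V} \<noteq> {}"
        using V Z W openin_subset by blast
      ultimately show "\<exists>V. openin S V \<and> V \<noteq> {} \<and> V \<subseteq> W \<and> V \<subseteq> g -` G n"
        using V(4) by (intro exI[of _ "W \<inter> {x \<in> topspace S. g x \<in> V}"]) auto
    qed
  next
    fix x assume "x \<in> topspace S" "\<And>n. x \<in> g -` G n"
    then show "x \<in> {x \<in> topspace S. g x \<in> R}"
      using G(2) g(1) by (fastforce simp: continuous_map_def)
  qed auto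
qed

subsection \<open>Irreducible and minimal maps\<close>

text \<open>Upper semicontinuity of fibres: the complement in \<open>Y\<close> is the image of the
  compact set \<open>X - U\<close>, hence closed.\<close>

lemma openin_fibre_subset:
  fixes g :: "'a::metric_space \<Rightarrow> 'b::metric_space"
  assumes X: "compact X" "continuous_on X g" "g ` X \<subseteq> Y" and U: "openin (top_of_set X) U"
  shows "openin (top_of_set Y) {y \<in> Y. \<forall>x\<in>X. g x = y \<longrightarrow> x \<in> U}"
proof -
  have "closedin (top_of_set X) (X - U)"
    using U by (simp add: closedin_diff)
  then have c: "compact (X - U)"
    using X(1) closedin_compact by blast
  have "compact (g ` (X - U))"
    by (rule compact_continuous_image[OF continuous_on_subset[OF X(2)] c]) auto
  then have "closedin (top_of_set Y) (g ` (X - U))"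
    using X(3) by (intro closed_subset compact_imp_closed) auto
  moreover have "{y \<in> Y. \<forall>x\<in>X. g x = y \<longrightarrow> x \<in> U} = Y - g ` (X - U)"
    by auto
  ultimately show ?thesis
    by (simp add: openin_diff)
qed

definition irreducible_map :: "'a::metric_space set \<Rightarrow> 'b::metric_space set \<Rightarrow> ('a \<Rightarrow> 'b) \<Rightarrow> bool" where
  "irreducible_map X Y g \<longleftrightarrow> g ` X = Y \<and>
     (\<forall>A. closedin (top_of_set X) A \<and> g ` A = Y \<longrightarrow> A = X)"

lemma irreducible_map_imp_onto: "irreducible_map X Y g \<Longrightarrow> g ` X = Y"
  by (simp add: irreducible_map_def)

lemma irreducible_mapD:
  "irreducible_map X Y g \<Longrightarrow> closedin (top_of_set X) A \<Longrightarrow> g ` A = Y \<Longrightarrow> A = X"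
  unfolding irreducible_map_def by blast

text \<open>If no fibre were contained in \<open>U\<close>, the proper closed subset
  \<open>X - U\<close> would still map onto \<open>Y\<close>.\<close>

lemma irreducible_map_open_contains_fibres:
  assumes X: "compact X" "continuous_on X g" "irreducible_map X Y g"
    and U: "openin (top_of_set X) U" "U \<noteq> {}"
  obtains V where "openin (top_of_set Y) V" "V \<noteq> {}" "\<And>x. x \<in> X \<Longrightarrow> g x \<in> V \<Longrightarrow> x \<in> U"
proof
  let ?V = "{y \<in> Y. \<forall>x\<in>X. g x = y \<longrightarrow> x \<in> U}"
  have gX: "g ` X = Y" using X(3) by (simp add: irreducible_map_def)
  show "openin (top_of_set Y) ?V"
    using openin_fibre_subset[OF X(1,2) _ U(1)] gX by auto
  show "?V \<noteq> {}"
  proof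
    assume "?V = {}"
    then have "y \<in> g ` (X - U)" if "y \<in> Y" for y
      using that by blast
    then have "g ` (X - U) = Y"
      using gX by blast
    moreover have "closedin (top_of_set X) (X - U)"
      using U by (simp add: closedin_diff)
    ultimately have "X - U = X"
      using X(3) unfolding irreducible_map_def by blast
    then show False
      using U openin_imp_subset[OF U(1)] by blast
  qed
qed auto

lemma irreducible_map_feebly_open:
  assumes "compact X" "continuous_on X g" "irreducible_map X Y g"
  shows "feebly_open (top_of_set X) (top_of_set Y) g"
  unfolding feebly_open_def
proof (intro allI impI)
  fix U assume U: "openin (top_of_set X) U \<and> U \<noteq> {}"
  then obtain V where V: "openin (top_of_set Y) V" "V \<noteq> {}" "\<And>x. x \<in> X \<Longrightarrow> g x \<in> V \<Longrightarrow> x \<in> U"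
    using irreducible_map_open_contains_fibres[OF assms] by metis
  have "V \<subseteq> g ` X"
    using openin_imp_subset[OF V(1)] assms(3) by (auto simp: irreducible_map_def)
  with V show "\<exists>V. openin (top_of_set Y) V \<and> V \<noteq> {} \<and> V \<subseteq> g ` U"
    by (intro exI[of _ V]) blast
qed

text \<open>Applied to small balls, the previous inclusion of whole fibres in \<open>U\<close>
  yields open sets of values with fibres of small diameter; intersecting over all scales leaves one
  point.\<close>

lemma irreducible_map_residual_singleton_fibres:
  assumes X: "compact X" "continuous_on X g" "irreducible_map X Y g"
  shows "residual_in (top_of_set Y) {y \<in> Y. \<forall>x\<in>X. \<forall>x'\<in>X. g x = y \<and> g x' = y \<longrightarrow> x = x'}"
proof (rule residual_inI[where G="\<lambda>n. {y \<in> Y. \<forall>x\<in>X. \<forall>x'\<in>X. g x = y \<and> g x' = y \<longrightarrow> dist x x' < inverse (Suc n)}"])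
  have gX: "g ` X = Y" using X(3) by (simp add: irreducible_map_def)
  fix n
  show "dense_interior_in (top_of_set Y) {y \<in> Y. \<forall>x\<in>X. \<forall>x'\<in>X. g x = y \<and> g x' = y \<longrightarrow> dist x x' < inverse (Suc n)}"
  proof (rule dense_interior_inI)
    fix W assume W: "openin (top_of_set Y) W" "W \<noteq> {}"
    obtain x where x: "x \<in> X" "g x \<in> W"
      using W gX openin_imp_subset[OF W(1)] by blast
    \<comment> \<open>Half the bound, since two points of \<open>ball x r\<close> are compared
      through the centre.\<close>
    define r where "r = inverse (real (Suc n)) / 2"
    have r: "r > 0" by (simp add: r_def)
    have "openin (top_of_set X) (X \<inter> g -` W)"
      by (rule continuous_openin_preimage[OF X(2) _ W(1)]) (use gX in auto)
    then have U: "openin (top_of_set X) (X \<inter> g -` W \<inter> ball x r)" "X \<inter> g -` W \<inter> ball x r \<noteq> {}"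
      using x r by (auto intro!: openin_Int_open)
    obtain V where V: "openin (top_of_set Y) V" "V \<noteq> {}"
      "\<And>x'. x' \<in> X \<Longrightarrow> g x' \<in> V \<Longrightarrow> x' \<in> X \<inter> g -` W \<inter> ball x r"
      using irreducible_map_open_contains_fibres[OF X U] by metis
    have "dist x1 x2 < inverse (Suc n)" if "x1 \<in> X" "x2 \<in> X" "g x1 \<in> V" "g x2 \<in> V" for x1 x2
    proof -
      have "dist x x1 < r" "dist x x2 < r"
        using V(3)[of x1] V(3)[of x2] that by auto
      then show ?thesis
        using dist_triangle3[of x1 x2 x] by (simp add: r_def)
    qed
    moreover have "V \<subseteq> Y" by (rule openin_imp_subset[OF V(1)])
    moreover have "V \<subseteq> W"
    proof
      fix y assume "y \<in> V"
      moreover then obtain z where "z \<in> X" "g z = y"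
        using \<open>V \<subseteq> Y\<close> gX by blast
      ultimately show "y \<in> W" using V(3)[of z] by auto
    qed
    ultimately show "\<exists>V. openin (top_of_set Y) V \<and> V \<noteq> {} \<and> V \<subseteq> W \<and>
       V \<subseteq> {y \<in> Y. \<forall>x\<in>X. \<forall>x'\<in>X. g x = y \<and> g x' = y \<longrightarrow> dist x x' < inverse (Suc n)}"
      using V(1,2) by (intro exI[of _ V]) auto
  qed
next
  fix y assume y: "y \<in> topspace (top_of_set Y)"
    "\<And>n. y \<in> {y \<in> Y. \<forall>x\<in>X. \<forall>x'\<in>X. g x = y \<and> g x' = y \<longrightarrow> dist x x' < inverse (Suc n)}"
  have "x = x'" if "x \<in> X" "x' \<in> X" "g x = y" "g x' = y" for x x'
  proof (rule ccontr)
    assume "x \<noteq> x'"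
    then obtain n where "inverse (Suc n) < dist x x'"
      using reals_Archimedean[of "dist x x'"] by auto
    with y(2)[of n] that show False by fastforce
  qed
  with y(1) show "y \<in> {y \<in> Y. \<forall>x\<in>X. \<forall>x'\<in>X. g x = y \<and> g x' = y \<longrightarrow> x = x'}"
    by auto
qed auto

section \<open>Iterates\<close>

lemma funpow_image_subset:
  "f ` X \<subseteq> X \<Longrightarrow> (f ^^ i) ` X \<subseteq> X"
  by (induction i) auto

lemma funpow_in:
  "f ` X \<subseteq> X \<Longrightarrow> x \<in> X \<Longrightarrow> (f ^^ i) x \<in> X"
  using funpow_image_subset[of f X i] by blast

lemma continuous_on_funpow:
  fixes f :: "'a::topological_space \<Rightarrow> 'a"
  assumes "continuous_on X f" "f ` X \<subseteq> X"
  shows "continuous_on X (f ^^ i)"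
proof (induction i)
  case (Suc i)
  have "continuous_on X (f \<circ> (f ^^ i))"
    using Suc funpow_image_subset[OF assms(2)] assms(1)
    by (intro continuous_on_compose) (auto intro: continuous_on_subset)
  then show ?case by simp
qed (auto simp: id_def)

lemma funpow_preimage:
  fixes f :: "'a::topological_space \<Rightarrow> 'a"
  assumes "continuous_on X f" "f ` X \<subseteq> X"
  shows openin_funpow_preimage: "openin (top_of_set X) W \<Longrightarrow> openin (top_of_set X) (X \<inter> (f ^^ i) -` W)"
    and closedin_funpow_preimage: "closedin (top_of_set X) W \<Longrightarrow> closedin (top_of_set X) (X \<inter> (f ^^ i) -` W)"
proof -
  have *: "(f ^^ i) \<in> X \<rightarrow> X" using funpow_in[OF assms(2)] by blast
  show "openin (top_of_set X) W \<Longrightarrow> openin (top_of_set X) (X \<inter> (f ^^ i) -` W)"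
    by (rule continuous_openin_preimage[OF continuous_on_funpow[OF assms] *])
  show "closedin (top_of_set X) W \<Longrightarrow> closedin (top_of_set X) (X \<inter> (f ^^ i) -` W)"
    by (rule continuous_closedin_preimage_gen[OF continuous_on_funpow[OF assms] *])
qed

text \<open>If \<open>A\<close> is mapped onto \<open>X\<close> by \<open>f ^^ Suc i\<close>, then
  the compact image of \<open>A\<close> under \<open>f ^^ i\<close> is mapped onto \<open>X\<close>
  by \<open>f\<close>. Irreducibility of \<open>f\<close> makes that image all of \<open>X\<close>,
  and the induction hypothesis then gives \<open>A = X\<close>.\<close>

lemma irreducible_map_funpow:
  fixes f :: "'a::metric_space \<Rightarrow> 'a"
  assumes X: "compact X" "continuous_on X f" "irreducible_map X X f"
  shows "irreducible_map X X (f ^^ i)"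
proof (induction i)
  case 0
  then show ?case by (auto simp: irreducible_map_def)
next
  case (Suc i)
  have fX: "f ` X = X" using X(3) by (simp add: irreducible_map_def)
  have "A = X" if A: "closedin (top_of_set X) A" "(f ^^ Suc i) ` A = X" for A
  proof -
    have "compact A" using A(1) X(1) closedin_compact by blast
    moreover have AX: "A \<subseteq> X" using A(1) closedin_imp_subset by blast
    ultimately have "compact ((f ^^ i) ` A)"
      using continuous_on_funpow[OF X(2)] fX
      by (intro compact_continuous_image) (auto intro: continuous_on_subset)
    moreover have "(f ^^ i) ` A \<subseteq> X"
      using funpow_in[of f X] fX AX by blast
    ultimately have "closedin (top_of_set X) ((f ^^ i) ` A)"
      by (intro closed_subset compact_imp_closed)
    moreover have "f ` (f ^^ i) ` A = X"
      using A(2) by (simp add: image_comp)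
    ultimately have "(f ^^ i) ` A = X"
      by (rule irreducible_mapD[OF X(3)])
    then show ?thesis
      by (rule irreducible_mapD[OF Suc A(1)])
  qed
  moreover have "(f ^^ Suc i) ` X = X"
  proof -
    have "(f ^^ Suc i) ` X = f ` (f ^^ i) ` X"
      by (simp add: image_comp)
    then show ?thesis
      using irreducible_map_imp_onto[OF Suc] fX by simp
  qed
  ultimately show ?case
    unfolding irreducible_map_def by blast
qed

text \<open>A closed set \<open>A\<close> mapped onto \<open>X\<close> contains backward orbit segments of every length, hence by
  compactness the nonempty closed invariant set of points whose whole forward orbit stays in \<open>A\<close>.\<close>

lemma minimal_map_irreducible:
  assumes X: "compact X" "X \<noteq> {}" "continuous_on X f" and min: "minimal_map X f"
  shows "irreducible_map X X f"
proof -
  have fX: "f ` X \<subseteq> X" and minD: "\<And>A. A \<subseteq> X \<Longrightarrow> closedin (top_of_set X) A \<Longrightarrow> A \<noteq> {} \<Longrightarrow> f ` A \<subseteq> A \<Longrightarrow> A = X"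
    using min by (auto simp: minimal_map_def)
  have "f ` X = X"
  proof (rule minD[OF fX])
    show "closedin (top_of_set X) (f ` X)"
      using X fX by (intro closed_subset compact_imp_closed compact_continuous_image)
  qed (use X fX in auto)
  moreover have "A = X" if A: "closedin (top_of_set X) A" "f ` A = X" for A
  proof -
    have AX: "A \<subseteq> X" using A(1) closedin_imp_subset by blast
    define C where "C n = X \<inter> (\<Inter>i\<le>n. X \<inter> (f ^^ i) -` A)" for n
    have cl: "closedin (top_of_set X) (X \<inter> (f ^^ i) -` A)" for i
      by (rule closedin_funpow_preimage[OF X(3) fX A(1)])
    have "closedin (top_of_set X) (C n)" for n
      unfolding C_def using cl by (intro closedin_Int closedin_Inter) auto
    moreover have "C n \<noteq> {}" for n
    proof -
      have "\<exists>x\<in>X. (f ^^ n) x = a \<and> (\<forall>i\<le>n. (f ^^ i) x \<in> A)" if "a \<in> A" for a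
        using that
      proof (induction n arbitrary: a)
        case 0
        then show ?case using AX by auto
      next
        case (Suc n)
        obtain a' where a': "a' \<in> A" "f a' = a"
          using A(2) AX Suc.prems by blast
        obtain x where "x \<in> X" "(f ^^ n) x = a'" "\<forall>i\<le>n. (f ^^ i) x \<in> A"
          using Suc.IH[OF a'(1)] by blast
        then show ?case
          using a' Suc.prems by (intro bexI[of _ x]) (auto simp: le_Suc_eq)
      qed
      moreover have "A \<noteq> {}" using A(2) X(2) by auto
      ultimately show ?thesis unfolding C_def by fastforce
    qed
    moreover have "decseq C"
      unfolding decseq_def C_def by fastforce
    ultimately have ne: "(\<Inter>n. C n) \<noteq> {}"
      using X(1) compact_space_imp_nest[of "top_of_set X" C]
      by (simp add: compact_space_subtopology)
    have "(\<Inter>n. C n) = X"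
    proof (rule minD)
      show "closedin (top_of_set X) (\<Inter>n. C n)"
        using \<open>\<And>n. closedin (top_of_set X) (C n)\<close> by (intro closedin_Inter) auto
      show "f ` (\<Inter>n. C n) \<subseteq> (\<Inter>n. C n)"
      proof clarify
        fix x n assume x: "x \<in> (\<Inter>n. C n)"
        have "x \<in> X" using x by (auto simp: C_def)
        then have fx: "f x \<in> X" using fX by blast
        have "(f ^^ i) (f x) \<in> A" for i
        proof -
          have "x \<in> C (Suc i)" using x by blast
          then have "(f ^^ Suc i) x \<in> A" unfolding C_def by blast
          then show ?thesis by (simp add: funpow_swap1)
        qed
        then show "f x \<in> C n" using fx by (auto simp: C_def)
      qed
    qed (use ne C_def in auto)
    then have "X \<subseteq> C 0" by blast
    then show "A = X" using AX by (auto simp: C_def)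
  qed
  ultimately show ?thesis unfolding irreducible_map_def by blast
qed

text \<open>The points whose whole orbit avoids \<open>W\<close> form a closed invariant set; if it
  contained \<open>x\<close>, minimality would make it all of \<open>X\<close>, yet it misses
  \<open>W\<close>.\<close>

lemma minimal_map_orbit_meets_open:
  assumes X: "compact X" "continuous_on X f" and min: "minimal_map X f"
    and W: "openin (top_of_set X) W" "W \<noteq> {}" and x: "x \<in> X"
  shows "\<exists>i. (f ^^ i) x \<in> W"
proof (rule ccontr)
  assume no: "\<not> ?thesis"
  have fX: "f ` X \<subseteq> X" using min by (auto simp: minimal_map_def)
  define A where "A = (\<Inter>i. X \<inter> (f ^^ i) -` (X - W))"
  have cl: "closedin (top_of_set X) (X \<inter> (f ^^ i) -` (X - W))" for i
    using W(1) by (intro closedin_funpow_preimage[OF X(2) fX]) (simp add: closedin_diff)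
  have "A = X"
  proof -
    have "closedin (top_of_set X) A"
      unfolding A_def using cl by (intro closedin_Inter) auto
    moreover have "A \<subseteq> X" by (auto simp: A_def)
    moreover have "A \<noteq> {}"
      using no x funpow_in[OF fX x] by (auto simp: A_def)
    moreover have "f ` A \<subseteq> A"
    proof clarify
      fix y assume y: "y \<in> A"
      have "y \<in> X \<inter> (f ^^ Suc i) -` (X - W)" for i
        using y unfolding A_def by blast
      then show "f y \<in> A"
        using fX by (auto simp: A_def funpow_swap1)
    qed
    ultimately show ?thesis
      using min unfolding minimal_map_def by blast
  qed
  then have "X \<subseteq> (f ^^ 0) -` (X - W)"
    unfolding A_def by blast
  then show False
    using W openin_imp_subset[OF W(1)] by auto
qed

text \<open>Finitely many preimages of \<open>W\<close> under iterates cover the compact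
  \<open>X\<close>; \<open>n\<close> exceeds all exponents that occur.\<close>

lemma minimal_map_uniform_hitting_time:
  assumes X: "compact X" "continuous_on X f" and min: "minimal_map X f"
    and W: "openin (top_of_set X) W" "W \<noteq> {}"
  obtains n where "\<And>x. x \<in> X \<Longrightarrow> \<exists>i<n. (f ^^ i) x \<in> W"
proof -
  have fX: "f ` X \<subseteq> X" using min by (auto simp: minimal_map_def)
  define C where "C i = X \<inter> (f ^^ i) -` W" for i
  have op: "openin (top_of_set X) (C i)" for i
    unfolding C_def by (rule openin_funpow_preimage[OF X(2) fX W(1)])
  have "X \<subseteq> \<Union>(range C)"
    using minimal_map_orbit_meets_open[OF X min W] by (auto simp: C_def)
  then obtain D where D: "D \<subseteq> range C" "finite D" "X \<subseteq> \<Union>D"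
    using X(1)[unfolded compact_eq_openin_cover, rule_format, of "range C"] op by auto
  then obtain I where I: "finite I" "D = C ` I"
    by (meson finite_subset_image)
  obtain n where n: "\<And>i. i \<in> I \<Longrightarrow> i < n"
    using I(1) by (meson finite_nat_set_iff_bounded)
  show thesis
  proof (rule that)
    fix x assume "x \<in> X"
    then show "\<exists>i<n. (f ^^ i) x \<in> W"
      using D(3) I(2) n by (auto simp: C_def)
  qed
qed

subsection \<open>Brouwer's characterisation of the Cantor set\<close>

definition ternary_value :: "(nat \<Rightarrow> bool) \<Rightarrow> real" where
  "ternary_value d = (\<Sum>n. (if d n then 2 else 0) / 3 ^ Suc n)"

lemma sums_ternary_tail: "(\<lambda>n. 2 / 3 ^ Suc (n + k) :: real) sums (1 / 3 ^ k)"
proof -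
  have "(\<lambda>n. (2 / 3 ^ Suc k) * (1 / 3) ^ n :: real) sums ((2 / 3 ^ Suc k) * (1 / (1 - 1 / 3)))"
    by (intro sums_mult geometric_sums) auto
  then show ?thesis
    by (simp add: power_add power_divide field_simps)
qed

lemma summable_ternary: "summable (\<lambda>n. (if d n then 2 else 0) / 3 ^ Suc n :: real)"
proof (rule summable_comparison_test')
  show "summable (\<lambda>n. 2 / 3 ^ Suc (n + 0) :: real)"
    using sums_ternary_tail[of 0] sums_summable by blast
qed auto

text \<open>The first differing digit contributes 2/3^(n+1) to \<open>d\<close>, while all later
  digits of \<open>e\<close> together contribute at most 1/3^(n+1).\<close>

lemma ternary_value_less:
  assumes "\<And>k. k < n \<Longrightarrow> d k = e k" "d n" "\<not> e n"
  shows "ternary_value e < ternary_value d"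
proof -
  let ?t = "\<lambda>d n. (if d n then 2 else 0) / 3 ^ Suc n :: real"
  have split: "ternary_value d = (\<Sum>k. ?t d (k + Suc n)) + (\<Sum>k<n. ?t d k) + ?t d n" for d
    unfolding ternary_value_def using suminf_split_initial_segment[OF summable_ternary, of d "Suc n"]
    by simp
  have "(\<Sum>k. ?t e (k + Suc n)) \<le> (\<Sum>k. 2 / 3 ^ Suc (k + Suc n))"
  proof (rule suminf_le)
    show "summable (\<lambda>k. ?t e (k + Suc n))"
      using summable_iff_shift[of "?t e" "Suc n"] summable_ternary by blast
    show "summable (\<lambda>k. 2 / 3 ^ Suc (k + Suc n) :: real)"
      using sums_ternary_tail[of "Suc n"] sums_summable by blast
  qed auto
  also have "\<dots> = 1 / 3 ^ Suc n"
    using sums_ternary_tail[of "Suc n"] by (rule sums_unique[symmetric])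
  also have "\<dots> < 2 / 3 ^ Suc n"
    by (simp add: field_simps)
  finally have "(\<Sum>k. ?t e (k + Suc n)) < ?t d n"
    using assms by simp
  moreover have "(\<Sum>k. ?t d (k + Suc n)) \<ge> 0"
    using summable_iff_shift[of "?t d" "Suc n"] summable_ternary[of d]
    by (intro suminf_nonneg) auto
  moreover have "(\<Sum>k<n. ?t d k) = (\<Sum>k<n. ?t e k)"
    using assms(1) by (intro sum.cong) auto
  moreover have "?t e n = 0"
    using assms by simp
  ultimately show ?thesis
    unfolding split[of d] split[of e] by linarith
qed

lemma inj_ternary_value: "inj ternary_value"
proof (rule injI, rule ccontr)
  fix d e assume eq: "ternary_value d = ternary_value e" and "d \<noteq> e"
  then obtain m where "d m \<noteq> e m" by auto
  define n where "n = (LEAST n. d n \<noteq> e n)"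
  have n: "d n \<noteq> e n" unfolding n_def by (rule LeastI) fact
  have less: "d k = e k" if "k < n" for k
    using not_less_Least[of k "\<lambda>n. d n \<noteq> e n"] that by (auto simp: n_def)
  show False
  proof (cases "d n")
    case True
    then show False using ternary_value_less[of n d e] less n eq by auto
  next
    case False
    then show False using ternary_value_less[of n e d] less n eq by auto
  qed
qed

lemma cantor_ternary_eq_range: "cantor_ternary = range ternary_value"
proof (intro equalityI subsetI)
  fix x assume "x \<in> cantor_ternary"
  then obtain d where d: "\<And>n. d n \<in> {0, 2::real}" "(\<lambda>n. d n / 3 ^ Suc n) sums x"
    by (auto simp: cantor_ternary_def)
  have "(\<lambda>n. d n / 3 ^ Suc n) = (\<lambda>n. (if d n = 2 then 2 else 0) / 3 ^ Suc n)"
  proof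
    fix n show "d n / 3 ^ Suc n = (if d n = 2 then 2 else 0) / 3 ^ Suc n"
      using d(1)[of n] by auto
  qed
  with d(2) have "(\<lambda>n. (if d n = 2 then 2 else 0) / 3 ^ Suc n) sums x"
    by (simp only:)
  then have "x = ternary_value (\<lambda>n. d n = 2)"
    unfolding ternary_value_def by (rule sums_unique)
  then show "x \<in> range ternary_value" by blast
next
  fix x assume "x \<in> range ternary_value"
  then obtain d where d: "x = ternary_value d" by blast
  have "(\<lambda>n. (if d n then 2 else 0) / 3 ^ Suc n) sums x"
    unfolding d ternary_value_def by (rule summable_sums[OF summable_ternary])
  then show "x \<in> cantor_ternary"
    unfolding cantor_ternary_def by (intro CollectI exI[of _ "\<lambda>n. if d n then 2 else 0"]) auto
qed

text \<open>The series converges uniformly by the Weierstrass test, whatever the digits are, so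
  continuity of each digit is enough.\<close>

lemma continuous_on_ternary_value:
  fixes d :: "'a::topological_space \<Rightarrow> nat \<Rightarrow> bool"
  assumes "\<And>n. continuous_on K (\<lambda>x. (if d x n then 2 else 0) :: real)"
  shows "continuous_on K (\<lambda>x. ternary_value (d x))"
  unfolding ternary_value_def
proof (rule uniform_limit_theorem)
  show "uniform_limit K (\<lambda>n x. \<Sum>i<n. (if d x i then 2 else 0) / 3 ^ Suc i :: real)
      (\<lambda>x. \<Sum>i. (if d x i then 2 else 0) / 3 ^ Suc i) sequentially"
  proof (rule Weierstrass_m_test)
    show "summable (\<lambda>n. 2 / 3 ^ Suc (n + 0) :: real)"
      using sums_ternary_tail[of 0] sums_summable by blast
  qed auto
  show "\<forall>\<^sub>F n in sequentially. continuous_on K (\<lambda>x. \<Sum>i<n. (if d x i then 2 else 0) / 3 ^ Suc i :: real)"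
    using assms by (intro always_eventually allI continuous_intros) auto
qed auto

text \<open>The base consists of balls around finite nets of \<open>K\<close> at every scale
  1/(n+1). The control on \<open>closure V\<close> later isolates a point of a fibre within a closed
  neighbourhood.\<close>

lemma compact_countable_base:
  fixes K :: "'a::metric_space set"
  assumes "compact K"
  obtains \<V> where "countable \<V>" "\<And>V. V \<in> \<V> \<Longrightarrow> open V"
    "\<And>x T. x \<in> K \<Longrightarrow> open T \<Longrightarrow> x \<in> T \<Longrightarrow> \<exists>V\<in>\<V>. x \<in> V \<and> closure V \<subseteq> T"
proof -
  have "\<exists>F. finite F \<and> K \<subseteq> (\<Union>z\<in>F. ball z (inverse (Suc n)))" for n
    by (rule compactE_image[OF assms, of K "\<lambda>z. ball z (inverse (Suc n))"]) auto
  then obtain F where F: "\<And>n. finite (F n)" "\<And>n. K \<subseteq> (\<Union>z\<in>F n. ball z (inverse (Suc n)))"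
    by metis
  define \<V> where "\<V> = (\<Union>n. (\<lambda>z. ball z (inverse (Suc n))) ` F n)"
  show thesis
  proof (rule that[of \<V>])
    show "countable \<V>"
      using F(1) by (auto simp: \<V>_def intro: countable_finite)
    show "open V" if "V \<in> \<V>" for V
      using that by (auto simp: \<V>_def)
    fix x T assume x: "x \<in> K" "open T" "x \<in> T"
    obtain e where e: "e > 0" "ball x e \<subseteq> T"
      using x open_contains_ball by blast
    \<comment> \<open>A closed ball of this radius that has \<open>x\<close> in its interior stays
      within two radii of \<open>x\<close>.\<close>
    obtain n where n: "inverse (Suc n) < e / 2"
      using reals_Archimedean[of "e / 2"] e by auto
    obtain z where z: "z \<in> F n" "x \<in> ball z (inverse (Suc n))"
      using F(2)[of n] x(1) by auto
    have "closure (ball z (inverse (Suc n))) \<subseteq> cball z (inverse (Suc n))"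
      by (simp add: closure_minimal)
    also have "\<dots> \<subseteq> ball x e"
    proof
      fix y assume "y \<in> cball z (inverse (Suc n))"
      then show "y \<in> ball x e"
        using z(2) n dist_triangle[of x y z] by (auto simp: dist_commute)
    qed
    also note e(2)
    finally show "\<exists>V\<in>\<V>. x \<in> V \<and> closure V \<subseteq> T"
      using z by (auto simp: \<V>_def)
  qed
qed

text \<open>A clopen set is open and compact, hence the trace of a finite union of members of a
  countable base, and there are countably many finite subfamilies.\<close>

lemma countable_clopen_subsets_compact:
  fixes K :: "'a::metric_space set"
  assumes "compact K"
  shows "countable {C. openin (top_of_set K) C \<and> closedin (top_of_set K) C}"
proof -
  obtain \<V> where \<V>: "countable \<V>" "\<And>V. V \<in> \<V> \<Longrightarrow> open V"
    "\<And>x T. x \<in> K \<Longrightarrow> open T \<Longrightarrow> x \<in> T \<Longrightarrow> \<exists>V\<in>\<V>. x \<in> V \<and> closure V \<subseteq> T"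
    using compact_countable_base[OF assms] by metis
  have "C \<in> (\<lambda>D. K \<inter> \<Union>D) ` {D. finite D \<and> D \<subseteq> \<V>}"
    if C: "openin (top_of_set K) C" "closedin (top_of_set K) C" for C
  proof -
    obtain T where T: "open T" "C = K \<inter> T"
      using C(1) by (auto simp: openin_open)
    have "compact C" using C(2) assms closedin_compact by blast
    then obtain D where D: "D \<subseteq> {V \<in> \<V>. closure V \<subseteq> T}" "finite D" "C \<subseteq> \<Union>D"
    proof (rule compactE)
      show "C \<subseteq> \<Union>{V \<in> \<V>. closure V \<subseteq> T}"
        using \<V>(3)[OF _ T(1)] T(2) by blast
    qed (use \<V>(2) in auto)
    have "V \<subseteq> T" if "V \<in> D" for V
      using that D(1) closure_subset by blast
    then have "C = K \<inter> \<Union>D"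
      using D(3) T(2) by blast
    then show ?thesis using D by blast
  qed
  then have "{C. openin (top_of_set K) C \<and> closedin (top_of_set K) C}
      \<subseteq> (\<lambda>D. K \<inter> \<Union>D) ` {D. finite D \<and> D \<subseteq> \<V>}"
    by blast
  then show ?thesis
    using countable_Collect_finite_subset[OF \<V>(1)] by (meson countable_image countable_subset)
qed

text \<open>In a compact Hausdorff space quasi-components and components coincide, and here the
  components are points.\<close>

lemma compact_totally_disconnected_clopen_separation:
  fixes K :: "'a::metric_space set"
  assumes K: "compact K" and td: "\<forall>S. S \<subseteq> K \<and> connected S \<longrightarrow> (\<exists>a. S \<subseteq> {a})"
    and xy: "x \<in> K" "y \<in> K" "x \<noteq> y"
  obtains C where "openin (top_of_set K) C" "closedin (top_of_set K) C" "x \<in> C" "y \<notin> C"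
proof -
  have "quasi_component_of (top_of_set K) x = connected_component_of (top_of_set K) x"
    using K by (intro quasi_eq_connected_component_of)
      (simp add: compact_space_subtopology Hausdorff_space_subtopology)
  moreover have "\<not> connected_component_of (top_of_set K) x y"
  proof
    assume "connected_component_of (top_of_set K) x y"
    then obtain S where S: "S \<subseteq> K" "connected S" "x \<in> S" "y \<in> S"
      by (auto simp: connected_component_of_def connectedin_subtopology)
    then obtain a where "S \<subseteq> {a}" using td by blast
    with S xy show False by blast
  qed
  ultimately have "\<not> quasi_component_of (top_of_set K) x y" by simp
  then obtain C where C: "closedin (top_of_set K) C" "openin (top_of_set K) C" "(x \<in> C) \<noteq> (y \<in> C)"
    using xy by (auto simp: quasi_component_of_def)
  show thesis
  proof (cases "x \<in> C")
    case True
    then show thesis using that C by blast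
  next
    case False
    then show thesis
      using that[of "K - C"] C xy
      by (metis Diff_iff closedin_diff closedin_topspace openin_diff openin_topspace topspace_euclidean_subtopology)
  qed
qed


text \<open>Enumerate the clopen sets as \<open>C 0, C 1, \<dots>\<close> and split \<open>K\<close> successively into two nonempty clopen
  halves, at step \<open>n\<close> along \<open>C n\<close> wherever \<open>C n\<close> cuts a cell properly. The itinerary of a point,
  read as ternary digits, is the homeomorphism.\<close>

theorem perfect_totally_disconnected_compact_imp_cantor_set:
  fixes K :: "'a::metric_space set"
  assumes K: "compact K" "K \<noteq> {}"
    and td: "\<forall>S. S \<subseteq> K \<and> connected S \<longrightarrow> (\<exists>a. S \<subseteq> {a})"
    and perfect: "\<And>x. x \<in> K \<Longrightarrow> x islimpt K"
  shows "cantor_set K"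
proof -
  define clo where "clo A \<longleftrightarrow> openin (top_of_set K) A \<and> closedin (top_of_set K) A" for A
  have clo_Int: "clo (A \<inter> A')" and clo_Diff: "clo (A - A')" if "clo A" "clo A'" for A A'
    using that by (auto simp: clo_def)
  have clo_K: "clo K" by (auto simp: clo_def)
  have clo_sub: "A \<subseteq> K" if "clo A" for A
    using that openin_imp_subset unfolding clo_def by blast
  have sep: "\<exists>C. clo C \<and> x \<in> C \<and> y \<notin> C" if "x \<in> K" "y \<in> K" "x \<noteq> y" for x y
    using compact_totally_disconnected_clopen_separation[OF K(1) td that] unfolding clo_def by metis
  have cnt: "countable {A. clo A}" and ne: "{A. clo A} \<noteq> {}"
    using countable_clopen_subsets_compact[OF K(1)] clo_K by (auto simp: clo_def)
  define C where "C = from_nat_into {A. clo A}"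
  have cloC: "clo (C n)" for n
    using from_nat_into[OF ne, of n] by (simp add: C_def)
  have surjC: "\<exists>n. C n = A" if "clo A" for A
    using from_nat_into_surj[OF cnt, of A] that by (auto simp: C_def)
  \<comment> \<open>The guard \<open>clo A \<and> A \<noteq> {}\<close> makes a suitable
    \<open>D\<close> exist for every \<open>n\<close> and \<open>A\<close>, so that choice gives a
    total function. The last clause forces the cut along \<open>C n\<close> whenever it is proper,
    which yields injectivity.\<close>
  define splits where "splits n A D \<longleftrightarrow> (clo A \<and> A \<noteq> {} \<longrightarrow> clo D \<and> D \<subseteq> A \<and> D \<noteq> {} \<and> D \<noteq> A \<and>
      (A \<inter> C n \<noteq> {} \<and> A \<inter> C n \<noteq> A \<longrightarrow> D = A \<inter> C n))" for n A D
  have "\<exists>D. splits n A D" for n A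
  proof (cases "clo A \<and> A \<noteq> {}")
    case True
    then have A: "clo A" and "A \<noteq> {}" by auto
    then obtain x where x: "x \<in> A" by blast
    obtain T where T: "open T" "A = K \<inter> T"
      using A by (auto simp: clo_def openin_open)
    show ?thesis
    proof (cases "A \<inter> C n \<noteq> {} \<and> A \<inter> C n \<noteq> A")
      case True
      then show ?thesis unfolding splits_def using clo_Int[OF A cloC, of n] by (intro exI[of _ "A \<inter> C n"]) auto
    next
      case False
      \<comment> \<open>Here \<open>C n\<close> does not cut \<open>A\<close>. As \<open>A\<close>
        is open in the perfect \<open>K\<close>, it has a second point, and any clopen set
        separating the two cuts it.\<close>
      obtain y where y: "y \<in> A" "y \<noteq> x"
        using perfect[of x] x T unfolding islimpt_def by blast
      obtain C' where C': "clo C'" "x \<in> C'" "y \<notin> C'"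
        using sep[of x y] x y clo_sub[OF A] by auto
      have "A \<inter> C' \<noteq> A" using y C' by blast
      then show ?thesis unfolding splits_def using False clo_Int[OF A C'(1)] x C'(2) by (intro exI[of _ "A \<inter> C'"]) auto
    qed
  qed (auto simp: splits_def)
  then obtain D where "\<And>n A. splits n A (D n A)"
    by metis
  note D = this[unfolded splits_def]
  define cell where "cell x = rec_nat K (\<lambda>n A. if x \<in> D n A then D n A else A - D n A)" for x
  define digit where "digit x n \<longleftrightarrow> x \<in> D n (cell x n)" for x n
  have cell_0: "cell x 0 = K" for x by (simp add: cell_def)
  have cell_Suc: "cell x (Suc n) = (if digit x n then D n (cell x n) else cell x n - D n (cell x n))" for x n
    by (simp add: cell_def digit_def)
  have cell: "clo (cell x n) \<and> x \<in> cell x n" if "x \<in> K" for x n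
  proof (induction n)
    case 0
    then show ?case using clo_K that by (simp add: cell_0)
  next
    case (Suc n)
    then have "clo (D n (cell x n))" using D[of "cell x n" n] by blast
    with Suc show ?case
      unfolding cell_Suc using clo_Diff by (auto simp: digit_def)
  qed
  have cell_mono: "cell x (Suc n) \<subseteq> cell x n" if "x \<in> K" for x n
    using D[of "cell x n" n] cell[OF that, of n] unfolding cell_Suc by auto
  \<comment> \<open>The cells of one level form a partition; consequently each digit is constant on
    the clopen cells of the next level.\<close>
  have cell_eq: "cell y n = cell x n" if "x \<in> K" "y \<in> cell x n" for x y n
    using that(2)
  proof (induction n)
    case (Suc n)
    then have eq: "cell y n = cell x n"
      using cell_mono[OF that(1)] by blast
    have "digit y n \<longleftrightarrow> digit x n"
      using Suc.prems eq unfolding cell_Suc by (auto simp: digit_def split: if_splits)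
    then show ?case by (simp add: cell_Suc eq)
  qed (simp add: cell_0)
  have digits_cell: "(\<forall>k<n. digit x k = digit y k) \<longrightarrow> cell x n = cell y n" for x y n
    by (induction n) (auto simp: cell_0 cell_Suc)
  let ?\<psi> = "\<lambda>x. ternary_value (digit x)"
  have cont: "continuous_on K ?\<psi>"
  proof (rule continuous_on_ternary_value)
    fix n
    show "continuous_on K (\<lambda>x. (if digit x n then 2 else 0) :: real)"
      unfolding continuous_on_topological
    proof (intro ballI allI impI)
      fix x and B :: "real set" assume x: "x \<in> K" "open B" "(if digit x n then 2 else 0) \<in> B"
      obtain T where T: "open T" "cell x (Suc n) = K \<inter> T"
        using cell[OF x(1), of "Suc n"] by (auto simp: clo_def openin_open)
      have "digit y n = digit x n" if "y \<in> cell x (Suc n)" for y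
      proof -
        have "cell y n = cell x n"
          using that cell_mono[OF x(1)] by (intro cell_eq[OF x(1)]) blast
        then show ?thesis
          using that unfolding cell_Suc by (auto simp: digit_def split: if_splits)
      qed
      then have "\<forall>y\<in>K. y \<in> T \<longrightarrow> (if digit y n then 2 else 0) \<in> B"
        using T(2) x(3) by simp
      moreover have "x \<in> T"
        using cell[OF x(1), of "Suc n"] T(2) by blast
      ultimately show "\<exists>A. open A \<and> x \<in> A \<and> (\<forall>y\<in>K. y \<in> A \<longrightarrow> (if digit y n then 2 else 0) \<in> B)"
        using T(1) by blast
    qed
  qed
  have inj: "inj_on ?\<psi> K"
  proof (rule inj_onI, rule ccontr)
    fix x y assume xy: "x \<in> K" "y \<in> K" "?\<psi> x = ?\<psi> y" "x \<noteq> y"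
    have digits: "digit x = digit y"
      using xy(3) inj_ternary_value by (simp add: inj_eq)
    \<comment> \<open>The separating set occurs as some \<open>C n\<close>. With equal digits both
      points still share a cell at stage \<open>n\<close>, and there \<open>C n\<close> must have
      given them different digits.\<close>
    obtain C' where "clo C'" "x \<in> C'" "y \<notin> C'" using sep[OF xy(1,2,4)] by blast
    then obtain n where n: "x \<in> C n" "y \<notin> C n" using surjC by blast
    have eq: "cell x n = cell y n" using digits_cell digits by auto
    let ?A = "cell x n"
    have "clo ?A" "x \<in> ?A" "y \<in> ?A"
      using cell[OF xy(1), of n] cell[OF xy(2), of n] eq by auto
    then have "D n ?A = ?A \<inter> C n"
      using D[of ?A n] n by blast
    then have "digit x n" "\<not> digit y n"
      using n \<open>x \<in> ?A\<close> eq by (auto simp: digit_def)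
    with digits show False by simp
  qed
  have onto: "?\<psi> ` K = cantor_ternary"
  proof -
    have "\<exists>x\<in>K. digit x = s" for s
    proof -
      \<comment> \<open>The cells prescribed by the itinerary \<open>s\<close>: they are nested,
        nonempty and closed, so compactness provides a point in all of them.\<close>
      define A where "A = rec_nat K (\<lambda>n A. if s n then D n A else A - D n A)"
      have A_0: "A 0 = K" and A_Suc: "\<And>n. A (Suc n) = (if s n then D n (A n) else A n - D n (A n))"
        by (simp_all add: A_def)
      have A: "clo (A n) \<and> A n \<noteq> {}" for n
      proof (induction n)
        case 0
        then show ?case using clo_K K by (simp add: A_0)
      next
        case (Suc n)
        then have "clo (D n (A n))" "D n (A n) \<subseteq> A n" "D n (A n) \<noteq> {}" "D n (A n) \<noteq> A n"
          using D[of "A n" n] by auto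
        then show ?case using Suc clo_Diff[of "A n" "D n (A n)"] by (auto simp: A_Suc)
      qed
      have "A (Suc n) \<subseteq> A n" for n
        using D[of "A n" n] A[of n] by (auto simp: A_Suc)
      then have "decseq A" by (rule decseq_SucI)
      then have "(\<Inter>n. A n) \<noteq> {}"
        using compact_space_imp_nest[of "top_of_set K" A] A K(1)
        by (simp add: compact_space_subtopology clo_def)
      then obtain x where x: "\<And>n. x \<in> A n" by blast
      have "x \<in> K" using x[of 0] by (simp add: A_0)
      moreover have "cell x n = A n \<and> digit x n = s n" for n
      proof (induction n)
        case 0
        then show ?case using x[of 1] by (auto simp: cell_0 A_0 A_Suc digit_def split: if_splits)
      next
        case (Suc n)
        then have "cell x (Suc n) = A (Suc n)" by (simp add: cell_Suc A_Suc)
        then show ?case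
          using x[of "Suc (Suc n)"] unfolding A_Suc[of "Suc n"] by (auto simp: digit_def split: if_splits)
      qed
      ultimately show ?thesis by blast
    qed
    then have "digit ` K = UNIV" by (metis (no_types, lifting) UNIV_eq_I image_eqI)
    then show ?thesis
      unfolding cantor_ternary_eq_range by (metis image_image)
  qed
  show ?thesis
    unfolding cantor_set_def by (rule homeomorphic_compact[OF K(1) cont onto inj])
qed

subsection \<open>Generic fibres are totally disconnected\<close>

text \<open>Its complement in the graph is compact: the other arcs together with the rest of this
  arc. These miss the subarc because arcs meet only at end-points and are injective.\<close>

lemma openin_graph_open_subarc:
  fixes \<Gamma> :: "'g::metric_space set"
  assumes gs: "\<forall>g\<in>set gs. arc g" "\<Gamma> = (\<Union>g\<in>set gs. path_image g)"
    "\<forall>i<length gs. \<forall>j<length gs. i \<noteq> j \<longrightarrow>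
            path_image (gs!i) \<inter> path_image (gs!j)
              \<subseteq> {pathstart (gs!i), pathfinish (gs!i)} \<inter> {pathstart (gs!j), pathfinish (gs!j)}"
    and i: "i < length gs" and st: "0 \<le> s" "t \<le> 1"
  shows "openin (top_of_set \<Gamma>) ((gs!i) ` {s<..<t})"
proof -
  define g where "g = gs!i"
  have arc_j: "arc (gs!j)" if "j < length gs" for j using gs(1) that by auto
  have g: "continuous_on {0..1} g" "inj_on g {0..1}"
    using arc_j[OF i] by (auto simp: g_def arc_def path_def)
  define Z where "Z = (\<Union>j\<in>{..<length gs} - {i}. path_image (gs!j)) \<union> g ` ({0..1} - {s<..<t})"
  have "compact (path_image (gs!j))" if "j < length gs" for j
    using arc_j[OF that] by (simp add: arc_imp_path compact_path_image)
  moreover have "compact (g ` ({0..1} - {s<..<t}))"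
  proof (rule compact_continuous_image)
    show "compact ({0..1} - {s<..<t})"
      by (intro compact_diff) auto
  qed (use g in \<open>auto intro: continuous_on_subset\<close>)
  ultimately have "compact Z"
    unfolding Z_def by (intro compact_Un compact_UN) auto
  moreover have \<Gamma>: "\<Gamma> = (\<Union>j<length gs. path_image (gs!j))"
    unfolding gs(2) by (auto simp: set_conv_nth)
  have "Z \<subseteq> \<Gamma>"
    unfolding Z_def \<Gamma> using i by (auto simp: g_def path_image_def)
  ultimately have "closedin (top_of_set \<Gamma>) Z"
    by (intro closed_subset compact_imp_closed)
  moreover have "g ` {s<..<t} = \<Gamma> - Z"
  proof (intro equalityI subsetI)
    fix x assume "x \<in> g ` {s<..<t}"
    then obtain u where u: "s < u" "u < t" "x = g u" by auto
    have "x \<in> path_image (gs!i)" using u st by (auto simp: path_image_def g_def)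
    then have "x \<in> \<Gamma>" using i by (auto simp: \<Gamma>)
    moreover have "x \<notin> g ` ({0..1} - {s<..<t})"
    proof
      assume "x \<in> g ` ({0..1} - {s<..<t})"
      then obtain v where "v \<in> {0..1}" "v \<notin> {s<..<t}" "g v = g u" using u by auto
      then show False using inj_onD[OF g(2), of v u] u st by auto
    qed
    moreover have "x \<notin> path_image (gs!j)" if "j < length gs" "j \<noteq> i" for j
    proof
      assume "x \<in> path_image (gs!j)"
      then have "x = g 0 \<or> x = g 1"
        using gs(3) i that \<open>x \<in> path_image (gs!i)\<close> unfolding pathstart_def pathfinish_def g_def by blast
      then show False
        using inj_onD[OF g(2), of 0 u] inj_onD[OF g(2), of 1 u] u st by auto
    qed
    ultimately show "x \<in> \<Gamma> - Z" unfolding Z_def by auto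
  next
    fix x assume x: "x \<in> \<Gamma> - Z"
    then have "x \<in> path_image g"
      unfolding Z_def \<Gamma> g_def by auto
    then obtain u where "u \<in> {0..1}" "x = g u" by (auto simp: path_image_def)
    then show "x \<in> g ` {s<..<t}" using x unfolding Z_def by blast
  qed
  ultimately show ?thesis
    by (simp add: g_def openin_diff)
qed

text \<open>Points outside \<open>K\<close> are dense in every arc. If \<open>S\<close> contains an
  interior point of an arc, two such points on either side of it cut out a clopen part of
  \<open>S\<close>; otherwise \<open>S\<close> consists of end-points and is finite. Rational
  parameters keep the family of subarcs countable.\<close>

lemma graph_connected_subset_of_codense:
  fixes \<Gamma> :: "'g::metric_space set"
  assumes gs: "\<forall>g\<in>set gs. arc g" "\<Gamma> = (\<Union>g\<in>set gs. path_image g)"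
    "\<forall>i<length gs. \<forall>j<length gs. i \<noteq> j \<longrightarrow>
            path_image (gs!i) \<inter> path_image (gs!j)
              \<subseteq> {pathstart (gs!i), pathfinish (gs!i)} \<inter> {pathstart (gs!j), pathfinish (gs!j)}"
    and K: "K \<subseteq> \<Gamma>"
    "\<And>i s t. i < length gs \<Longrightarrow> s \<in> \<rat> \<Longrightarrow> t \<in> \<rat> \<Longrightarrow> 0 \<le> s \<Longrightarrow> s < t \<Longrightarrow> t \<le> 1 \<Longrightarrow> \<not> (gs!i) ` {s<..<t} \<subseteq> K"
    and S: "S \<subseteq> K" "connected S"
  shows "\<exists>a. S \<subseteq> {a}"
proof (cases "\<exists>x\<in>S. \<exists>i<length gs. \<exists>u. 0 < u \<and> u < 1 \<and> x = (gs!i) u")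
  case True
  then obtain x i u where x: "x \<in> S" "i < length gs" "0 < u" "u < 1" "x = (gs!i) u" by blast
  define g where "g = gs!i"
  have g: "continuous_on {0..1} g" "inj_on g {0..1}"
    using gs(1) x(2) by (auto simp: g_def arc_def path_def)
  have dense: "\<exists>r. a < r \<and> r < b \<and> g r \<notin> K" if ab: "0 \<le> a" "a < b" "b \<le> 1" for a b
  proof -
    obtain q1 where q1: "q1 \<in> \<rat>" "a < q1" "q1 < b" using Rats_dense_in_real[OF ab(2)] by blast
    obtain q2 where q2: "q2 \<in> \<rat>" "q1 < q2" "q2 < b" using Rats_dense_in_real[OF q1(3)] by blast
    have "\<not> g ` {q1<..<q2} \<subseteq> K"
      unfolding g_def using K(2)[OF x(2) q1(1) q2(1)] q1 q2 ab by auto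
    then have "\<exists>r\<in>{q1<..<q2}. g r \<notin> K" by blast
    then obtain r where r: "q1 < r" "r < q2" "g r \<notin> K" by auto
    then show ?thesis using q1 q2 by (intro exI[of _ r]) auto
  qed
  have "y = x" if y: "y \<in> S" for y
  proof (rule ccontr)
    assume "y \<noteq> x"
    \<comment> \<open>A parameter interval around \<open>u\<close> whose subarc misses
      \<open>y\<close>: it stops at the parameter of \<open>y\<close> if \<open>y\<close> lies on
      this arc.\<close>
    have "\<exists>a b. 0 \<le> a \<and> a < u \<and> u < b \<and> b \<le> 1 \<and> y \<notin> g ` {a<..<b}"
    proof (cases "\<exists>v\<in>{0..1}. y = g v")
      case True
      then obtain v where v: "v \<in> {0..1}" "y = g v" by blast
      have uniq: "w = v" if "w \<in> {0..1}" "g w = y" for w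
        using inj_onD[OF g(2), of w v] v that by auto
      have "v \<noteq> u" using v \<open>y \<noteq> x\<close> x(5) by (auto simp: g_def)
      then consider "v < u" | "u < v" by linarith
      then show ?thesis
      proof cases
        case 1
        have "y \<notin> g ` {v<..<1}"
        proof
          assume "y \<in> g ` {v<..<1}"
          then obtain w where "w \<in> {v<..<1}" "g w = y" by auto
          then show False using uniq[of w] v by auto
        qed
        then show ?thesis using 1 v x by (intro exI[of _ v] exI[of _ 1]) auto
      next
        case 2
        have "y \<notin> g ` {0<..<v}"
        proof
          assume "y \<in> g ` {0<..<v}"
          then obtain w where "w \<in> {0<..<v}" "g w = y" by auto
          then show False using uniq[of w] v by auto
        qed
        then show ?thesis using 2 v x by (intro exI[of _ 0] exI[of _ v]) auto
      qed
    next
      case False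
      then show ?thesis using x by (intro exI[of _ 0] exI[of _ 1]) auto
    qed
    then obtain a b where ab: "0 \<le> a" "a < u" "u < b" "b \<le> 1" "y \<notin> g ` {a<..<b}" by blast
    obtain s where s: "a < s" "s < u" "g s \<notin> K" using dense[of a u] ab x by auto
    obtain t where t: "u < t" "t < b" "g t \<notin> K" using dense[of u b] ab x by auto
    have "openin (top_of_set \<Gamma>) (g ` {s<..<t})"
      unfolding g_def by (rule openin_graph_open_subarc[OF gs x(2)]) (use s t ab in auto)
    then obtain T where T: "open T" "g ` {s<..<t} = \<Gamma> \<inter> T"
      by (auto simp: openin_open)
    then have "S \<inter> g ` {s<..<t} = S \<inter> T"
      using S(1) K(1) by blast
    then have op: "openin (top_of_set S) (S \<inter> g ` {s<..<t})"
      using T(1) by (simp add: openin_open_Int)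
    have "compact (g ` {s..t})"
      by (intro compact_continuous_image continuous_on_subset[OF g(1)]) (use s t ab in auto)
    then have "closedin (top_of_set S) (S \<inter> g ` {s..t})"
      by (simp add: closedin_closed_Int compact_imp_closed)
    \<comment> \<open>The end-points \<open>g s\<close> and \<open>g t\<close> lie outside
      \<open>K\<close>, so the compact and the open subarc have the same trace on \<open>S\<close>;
      the trace is therefore clopen.\<close>
    moreover have "S \<inter> g ` {s..t} = S \<inter> g ` {s<..<t}"
    proof -
      have "{s..t} = insert s (insert t {s<..<t})" using s t by auto
      then show ?thesis using s(3) t(3) S(1) by auto
    qed
    ultimately have "S \<inter> g ` {s<..<t} = {} \<or> S \<inter> g ` {s<..<t} = S"
      using S(2) op unfolding connected_clopen by simp
    moreover have "x \<in> S \<inter> g ` {s<..<t}"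
      using x s t by (auto simp: g_def)
    moreover have "y \<notin> g ` {s<..<t}"
      using ab(5) s t by auto
    ultimately show False using y by blast
  qed
  then show ?thesis by blast
next
  case False
  have "S \<subseteq> (\<Union>i<length gs. {(gs!i) 0, (gs!i) 1})"
  proof
    fix x assume x: "x \<in> S"
    then obtain g where "g \<in> set gs" "x \<in> path_image g"
      using S(1) K(1) gs(2) by blast
    then obtain i u where iu: "i < length gs" "u \<in> {0..1}" "x = (gs!i) u"
      by (auto simp: path_image_def in_set_conv_nth)
    then have "\<not> (0 < u \<and> u < 1)" using False x by blast
    then have "u = 0 \<or> u = 1" using iu(2) by auto
    then show "x \<in> (\<Union>i<length gs. {(gs!i) 0, (gs!i) 1})" using iu by auto
  qed
  then have "finite S" by (rule finite_subset) auto
  then have "S = {} \<or> (\<exists>a. S = {a})"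
    using S(2) connected_finite_iff_sing by blast
  then show ?thesis by blast
qed

text \<open>Reduces total disconnectedness to countably many conditions, each of which can be shown
  generic over the base.\<close>

lemma graph_countable_open_family:
  assumes "is_graph \<Gamma>"
  obtains \<U> where "countable \<U>" "\<forall>U\<in>\<U>. openin (top_of_set \<Gamma>) U \<and> U \<noteq> {}"
    "\<forall>K S. K \<subseteq> \<Gamma> \<and> (\<forall>U\<in>\<U>. \<not> U \<subseteq> K) \<and> S \<subseteq> K \<and> connected S \<longrightarrow> (\<exists>a. S \<subseteq> {a})"
proof -
  obtain gs where gs: "\<forall>g\<in>set gs. arc g" "\<Gamma> = (\<Union>g\<in>set gs. path_image g)"
    "\<forall>i<length gs. \<forall>j<length gs. i \<noteq> j \<longrightarrow>
            path_image (gs!i) \<inter> path_image (gs!j)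
              \<subseteq> {pathstart (gs!i), pathfinish (gs!i)} \<inter> {pathstart (gs!j), pathfinish (gs!j)}"
    using assms unfolding is_graph_def by blast
  define I where "I = {..<length gs} \<times> {(s, t) \<in> \<rat> \<times> \<rat>. 0 \<le> s \<and> s < t \<and> t \<le> (1::real)}"
  define \<U> where "\<U> = (\<lambda>(i, s, t). (gs!i) ` {s<..<t}) ` I"
  show thesis
  proof (rule that[of \<U>])
    have "countable {(s, t) \<in> \<rat> \<times> \<rat>. 0 \<le> s \<and> s < t \<and> t \<le> (1::real)}"
      by (rule countable_subset[of _ "\<rat> \<times> \<rat>"]) (auto simp: countable_rat)
    then show "countable \<U>"
      unfolding \<U>_def I_def by auto
    show "\<forall>U\<in>\<U>. openin (top_of_set \<Gamma>) U \<and> U \<noteq> {}"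
      using openin_graph_open_subarc[OF gs] unfolding \<U>_def I_def by fastforce
    show "\<forall>K S. K \<subseteq> \<Gamma> \<and> (\<forall>U\<in>\<U>. \<not> U \<subseteq> K) \<and> S \<subseteq> K \<and> connected S \<longrightarrow> (\<exists>a. S \<subseteq> {a})"
    proof (intro allI impI, elim conjE)
      fix K S assume K: "K \<subseteq> \<Gamma>" "\<forall>U\<in>\<U>. \<not> U \<subseteq> K" and S: "S \<subseteq> K" "connected S"
      show "\<exists>a. S \<subseteq> {a}"
      proof (rule graph_connected_subset_of_codense[OF gs K(1) _ S])
        fix i s t assume "i < length gs" "s \<in> \<rat>" "t \<in> \<rat>" "0 \<le> s" "s < t" "t \<le> (1::real)"
        then have "(gs!i) ` {s<..<t} \<in> \<U>"
          unfolding \<U>_def I_def by force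
        then show "\<not> (gs!i) ` {s<..<t} \<subseteq> K" using K(2) by blast
      qed
    qed
  qed
qed

text \<open>For one chart and one member of the countable family, the base points at which the fibre
  of \<open>M\<close> does not fill that open set have dense interior: an open box contains a point
  outside the closed set \<open>M\<close>, and this persists for nearby base points. Compactness
  leaves finitely many charts.\<close>

lemma bundle_generic_fibre_totally_disconnected:
  assumes bdl: "compact_graph_bundle E B p \<Gamma>"
    and M: "closedin (top_of_set E) M" "nowhere_dense_in (top_of_set E) M"
  shows "residual_in (top_of_set B)
    {b \<in> B. \<forall>S. S \<subseteq> fibre p M b \<and> connected S \<longrightarrow> (\<exists>a. S \<subseteq> {a})}"
proof -
  have B: "compact B" and \<Gamma>: "is_graph \<Gamma>" and p: "continuous_on E p" "p ` E = B"
    using bdl by (auto simp: compact_graph_bundle_def)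
  define chart where "chart b U h k \<longleftrightarrow> openin (top_of_set B) U \<and> b \<in> U \<and>
      homeomorphism (E \<inter> p -` U) (U \<times> \<Gamma>) h k \<and> (\<forall>x\<in>E \<inter> p -` U. fst (h x) = p x)" for b U h k
  have "\<forall>b\<in>B. \<exists>U h k. chart b U h k"
    using bdl unfolding compact_graph_bundle_def chart_def by metis
  then obtain U h k where ch: "\<And>b. b \<in> B \<Longrightarrow> chart b (U b) (h b) (k b)"
    by metis
  have "\<forall>V\<in>U ` B. openin (top_of_set B) V" "B \<subseteq> \<Union>(U ` B)"
    using ch by (auto simp: chart_def)
  then obtain D where D: "D \<subseteq> U ` B" "finite D" "B \<subseteq> \<Union>D"
    using B[unfolded compact_eq_openin_cover, rule_format, of "U ` B"] by auto
  obtain A where "A \<subseteq> B" "finite A" "D = U ` A"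
    using finite_subset_image[OF D(2,1)] by auto
  with D(3) have A: "A \<subseteq> B" "finite A" "B \<subseteq> (\<Union>a\<in>A. U a)"
    by auto
  obtain \<U> where \<U>: "countable \<U>" "\<forall>V\<in>\<U>. openin (top_of_set \<Gamma>) V \<and> V \<noteq> {}"
    "\<forall>K S. K \<subseteq> \<Gamma> \<and> (\<forall>V\<in>\<U>. \<not> V \<subseteq> K) \<and> S \<subseteq> K \<and> connected S \<longrightarrow> (\<exists>a. S \<subseteq> {a})"
    by (rule graph_countable_open_family[OF \<Gamma>])
  \<comment> \<open>The condition is vacuous off the chart domain, so each set can be residual in
    all of \<open>B\<close>.\<close>
  define R where "R = (\<lambda>(a, V). {b \<in> B. b \<in> U a \<longrightarrow> (\<exists>v\<in>V. k a (b, v) \<notin> M)})"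
  have "residual_in (top_of_set B) (R (a, V))" if aV: "a \<in> A" "V \<in> \<U>" for a V
  proof (rule dense_interior_in_imp_residual_in)
    show "dense_interior_in (top_of_set B) (R (a, V))"
    proof (rule dense_interior_inI)
      fix W assume W: "openin (top_of_set B) W" "W \<noteq> {}"
      have c: "chart a (U a) (h a) (k a)" using ch aV A by blast
      then have Ua: "openin (top_of_set B) (U a)"
        and hom: "homeomorphism (E \<inter> p -` U a) (U a \<times> \<Gamma>) (h a) (k a)"
        by (auto simp: chart_def)
      have V: "openin (top_of_set \<Gamma>) V" "V \<noteq> {}" using \<U>(2) aV by auto
      show "\<exists>V'. openin (top_of_set B) V' \<and> V' \<noteq> {} \<and> V' \<subseteq> W \<and> V' \<subseteq> R (a, V)"
      proof (cases "W \<inter> U a = {}")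
        case True
        then have "W \<subseteq> R (a, V)"
          using openin_imp_subset[OF W(1)] by (auto simp: R_def)
        then show ?thesis using W by blast
      next
        case False
        let ?W1 = "W \<inter> U a"
        have oW1: "openin (top_of_set B) ?W1" using W Ua by blast
        have oW1U: "openin (top_of_set (U a)) ?W1"
          using oW1 openin_imp_subset[OF Ua] by (meson inf_le2 openin_subset_trans)
        have op: "openin (top_of_set (E \<inter> p -` U a)) (k a ` (?W1 \<times> V))"
        proof -
          have "openin (top_of_set (U a \<times> \<Gamma>)) (?W1 \<times> V)"
            by (rule openin_Times[OF oW1U V(1)])
          then show ?thesis
            by (rule homeomorphism_imp_open_map[OF homeomorphism_symD[OF hom]])
        qed
        moreover have "openin (top_of_set E) (E \<inter> p -` U a)"
          by (rule continuous_openin_preimage[OF p(1) _ Ua]) (use p in auto)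
        ultimately have "openin (top_of_set E) (k a ` (?W1 \<times> V))"
          by (rule openin_trans)
        moreover have "k a ` (?W1 \<times> V) \<noteq> {}" using False V by auto
        ultimately obtain Z where Z: "Z \<noteq> {}" "Z \<subseteq> k a ` (?W1 \<times> V)" "Z \<subseteq> E - M"
          using M(2) unfolding nowhere_dense_in_iff_dense_interior_in
          by (metis dense_interior_inE topspace_euclidean_subtopology)
        then obtain b0 v0 where bv: "b0 \<in> ?W1" "v0 \<in> V" "k a (b0, v0) \<notin> M" by blast
        \<comment> \<open>The graph coordinate \<open>v0\<close> is frozen and only the base point
          varies; the preimage of the open set \<open>E - M\<close> under this partial section is
          the required neighbourhood.\<close>
        have v0: "v0 \<in> \<Gamma>" using bv(2) openin_imp_subset[OF V(1)] by blast
        have "continuous_on (U a) (\<lambda>b. k a (b, v0))"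
          using v0 homeomorphism_cont2[OF hom]
          by (intro continuous_on_compose2[of _ "k a" _ "\<lambda>b. (b, v0)"] continuous_intros) auto
        moreover have "(\<lambda>b. k a (b, v0)) \<in> U a \<rightarrow> E"
          using v0 homeomorphism_image2[OF hom] by blast
        moreover have "openin (top_of_set E) (E - M)"
          using M(1) by (simp add: openin_diff)
        ultimately have "openin (top_of_set (U a)) (U a \<inter> (\<lambda>b. k a (b, v0)) -` (E - M))"
          by (rule continuous_openin_preimage)
        then have "openin (top_of_set B) (U a \<inter> (\<lambda>b. k a (b, v0)) -` (E - M))"
          using Ua by (rule openin_trans)
        then have "openin (top_of_set B) (W \<inter> (U a \<inter> (\<lambda>b. k a (b, v0)) -` (E - M)))"
          using W by blast
        moreover have "b0 \<in> W \<inter> (U a \<inter> (\<lambda>b. k a (b, v0)) -` (E - M))"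
          using bv v0 homeomorphism_image2[OF hom] by blast
        moreover have "W \<inter> (U a \<inter> (\<lambda>b. k a (b, v0)) -` (E - M)) \<subseteq> R (a, V)"
          using bv(2) openin_imp_subset[OF W(1)] by (auto simp: R_def)
        ultimately show ?thesis by blast
      qed
    qed
  qed (auto simp: R_def)
  then have "residual_in (top_of_set B) (topspace (top_of_set B) \<inter> (\<Inter>i\<in>A \<times> \<U>. R i))"
    using A(2) \<U>(1) by (intro residual_in_INT_countable) (auto intro: countable_finite)
  then show ?thesis
  proof (rule residual_in_mono)
    show "topspace (top_of_set B) \<inter> (\<Inter>i\<in>A \<times> \<U>. R i) \<subseteq>
       {b \<in> B. \<forall>S. S \<subseteq> fibre p M b \<and> connected S \<longrightarrow> (\<exists>a. S \<subseteq> {a})}"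
    proof clarsimp
      fix b S assume b: "b \<in> B" "\<forall>a\<in>A. \<forall>V\<in>\<U>. b \<in> R (a, V)" and S: "S \<subseteq> fibre p M b" "connected S"
      obtain a where a: "a \<in> A" "b \<in> U a" using b(1) A(3) by blast
      have c: "chart a (U a) (h a) (k a)" using ch a A by blast
      then have hom: "homeomorphism (E \<inter> p -` U a) (U a \<times> \<Gamma>) (h a) (k a)"
        and fst: "\<And>x. x \<in> E \<inter> p -` U a \<Longrightarrow> fst (h a x) = p x"
        by (auto simp: chart_def)
      have SE: "S \<subseteq> E \<inter> p -` U a"
        using S(1) a closedin_imp_subset[OF M(1)] by (auto simp: fibre_def)
      have hx: "h a x = (b, snd (h a x))" if "x \<in> S" for x
      proof -
        have "fst (h a x) = b"
          using fst[of x] that SE S(1) by (auto simp: fibre_def)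
        then show ?thesis by (metis prod.collapse)
      qed
      have kh: "k a (b, snd (h a x)) = x" if "x \<in> S" for x
        using homeomorphism_apply1[OF hom, of x] hx[OF that] that SE by (metis subsetD)
      \<comment> \<open>The fibre of \<open>M\<close> over \<open>b\<close> seen in the chart;
        \<open>S\<close> is moved into \<open>\<Gamma>\<close> by \<open>snd\<close> after
        \<open>h a\<close> and brought back by \<open>k a\<close>.\<close>
      let ?K = "{v \<in> \<Gamma>. k a (b, v) \<in> M}"
      have "\<exists>c. (\<lambda>x. snd (h a x)) ` S \<subseteq> {c}"
      proof (rule \<U>(3)[rule_format, of ?K], intro conjI ballI)
        show "\<not> V \<subseteq> ?K" if "V \<in> \<U>" for V
          using b(2) a that by (auto simp: R_def)
        show "(\<lambda>x. snd (h a x)) ` S \<subseteq> ?K"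
        proof clarify
          fix x assume x: "x \<in> S"
          have "h a x \<in> U a \<times> \<Gamma>"
            using homeomorphism_image1[OF hom] x SE by blast
          moreover have "x \<in> M" using x S(1) by (auto simp: fibre_def)
          ultimately show "snd (h a x) \<in> \<Gamma> \<and> k a (b, snd (h a x)) \<in> M"
            using kh[OF x] by auto
        qed
        show "connected ((\<lambda>x. snd (h a x)) ` S)"
          using homeomorphism_cont1[OF hom] SE
          by (intro connected_continuous_image[OF _ S(2)] continuous_on_snd) (rule continuous_on_subset)
      qed auto
      then obtain c where "\<And>x. x \<in> S \<Longrightarrow> snd (h a x) = c" by blast
      then have "S \<subseteq> {k a (b, c)}" using kh by fastforce
      then show "\<exists>a. S \<subseteq> {a}" by blast
    qed
  qed auto
qed

subsection \<open>Extensions of minimal systems\<close>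

text \<open>From here the bundle is left behind: what remains is a factor map between compact
  minimal systems, with \<open>M\<close> as a space of its own.\<close>

locale minimal_extension =
  fixes M :: "'e::metric_space set" and B :: "'b::metric_space set"
    and p :: "'e \<Rightarrow> 'b" and F :: "'e \<Rightarrow> 'e" and f :: "'b \<Rightarrow> 'b"
  assumes compact_M: "compact M" and compact_B: "compact B" and M_ne: "M \<noteq> {}"
    and p_cont: "continuous_on M p" and p_onto: "p ` M = B"
    and F_cont: "continuous_on M F" and f_cont: "continuous_on B f"
    and semiconj: "\<And>x. x \<in> M \<Longrightarrow> p (F x) = f (p x)"
    and F_min: "minimal_map M F" and f_min: "minimal_map B f"
begin

lemma F_maps: "F ` M \<subseteq> M" and f_maps: "f ` B \<subseteq> B"
  using F_min f_min by (auto simp: minimal_map_def)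

lemma p_in: "x \<in> M \<Longrightarrow> p x \<in> B"
  using p_onto by blast

lemma semiconj_funpow: "x \<in> M \<Longrightarrow> p ((F ^^ i) x) = (f ^^ i) (p x)"
  by (induction i) (auto simp: semiconj funpow_in[OF F_maps])

lemma irreducible_F: "irreducible_map M M (F ^^ i)"
  by (intro irreducible_map_funpow minimal_map_irreducible compact_M M_ne F_cont F_min)

lemma irreducible_f: "irreducible_map B B (f ^^ i)"
proof -
  have "B \<noteq> {}" using M_ne p_onto by auto
  then show ?thesis
    by (intro irreducible_map_funpow minimal_map_irreducible compact_B f_cont f_min)
qed

lemma residual_in_f_preimage:
  assumes "residual_in (top_of_set B) R"
  shows "residual_in (top_of_set B) {b \<in> B. (f ^^ i) b \<in> R}"
proof -
  have "continuous_map (top_of_set B) (top_of_set B) (f ^^ i)"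
    using continuous_on_funpow[OF f_cont f_maps] funpow_in[OF f_maps] by auto
  moreover have "feebly_open (top_of_set B) (top_of_set B) (f ^^ i)"
    by (rule irreducible_map_feebly_open[OF compact_B continuous_on_funpow[OF f_cont f_maps] irreducible_f])
  ultimately have "residual_in (top_of_set B) {b \<in> topspace (top_of_set B). (f ^^ i) b \<in> R}"
    by (rule residual_in_feebly_open_preimage[OF _ _ assms])
  then show ?thesis by simp
qed

text \<open>Irreducibility controls the preimages of generic values. Pulling the set of these values
  back along \<open>f ^^ i\<close> turns this into a property of the starting point
  \<open>b\<close>.\<close>

lemma residual_in_f_injective:
  "residual_in (top_of_set B) {b \<in> B. \<forall>b'\<in>B. (f ^^ i) b' = (f ^^ i) b \<longrightarrow> b' = b}"
proof -
  have "residual_in (top_of_set B) {y \<in> B. \<forall>x\<in>B. \<forall>x'\<in>B. (f ^^ i) x = y \<and> (f ^^ i) x' = y \<longrightarrow> x = x'}"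
    by (rule irreducible_map_residual_singleton_fibres[OF compact_B continuous_on_funpow[OF f_cont f_maps] irreducible_f])
  from residual_in_f_preimage[OF this, of i] show ?thesis
    by (rule residual_in_mono) auto
qed

lemma openin_fibre_tube:
  assumes "openin (top_of_set M) U"
  shows "openin (top_of_set B) {b \<in> B. fibre p M b \<subseteq> U}"
proof -
  have "openin (top_of_set B) {b \<in> B. \<forall>x\<in>M. p x = b \<longrightarrow> x \<in> U}"
    by (rule openin_fibre_subset[OF compact_M p_cont _ assms]) (simp add: p_onto)
  moreover have "{b \<in> B. fibre p M b \<subseteq> U} = {b \<in> B. \<forall>x\<in>M. p x = b \<longrightarrow> x \<in> U}"
    by (auto simp: fibre_def)
  ultimately show ?thesis by simp
qed

text \<open>The sets \<open>f\<^sup>-\<^sup>i(p(cl U'))\<close> cover \<open>B\<close> for every open \<open>U'\<close>, so one of them has interior by Baire.\<close>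

lemma feebly_open_p: "feebly_open (top_of_set M) (top_of_set B) p"
  unfolding feebly_open_def
proof (intro allI impI, elim conjE)
  fix U assume U: "openin (top_of_set M) U" "U \<noteq> {}"
  obtain x where x: "x \<in> U" using U(2) by blast
  obtain e where e: "e > 0" "cball x e \<inter> M \<subseteq> U"
    using U(1) x by (auto simp: openin_contains_cball)
  have xM: "x \<in> M" using x openin_imp_subset[OF U(1)] by blast
  define Q where "Q = p ` (M \<inter> cball x e)"
  have "compact (M \<inter> cball x e)"
    by (rule compact_Int_closed[OF compact_M]) simp
  then have "compact Q"
    unfolding Q_def by (intro compact_continuous_image continuous_on_subset[OF p_cont]) auto
  moreover have QB: "Q \<subseteq> B" using p_onto by (auto simp: Q_def)
  ultimately have Q: "closedin (top_of_set B) Q"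
    by (intro closed_subset compact_imp_closed)
  have hit: "\<exists>i. (f ^^ i) b \<in> Q" if b: "b \<in> B" for b
  proof -
    obtain y where y: "y \<in> M" "p y = b" using b p_onto by blast
    have "openin (top_of_set M) (M \<inter> ball x e)" "M \<inter> ball x e \<noteq> {}"
      using xM e by (auto intro: openin_open_Int)
    then obtain i where "(F ^^ i) y \<in> M \<inter> ball x e"
      using minimal_map_orbit_meets_open[OF compact_M F_cont F_min _ _ y(1)] by blast
    then have "p ((F ^^ i) y) \<in> Q" by (auto simp: Q_def)
    then show ?thesis using semiconj_funpow[OF y(1)] y(2) by auto
  qed
  have "\<exists>i. \<not> dense_interior_in (top_of_set B) (B - (f ^^ i) -` Q)"
  proof (rule ccontr)
    assume "\<not> ?thesis"
    then have "residual_in (top_of_set B) (\<Inter>i. B - (f ^^ i) -` Q)"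
      by (intro residual_in_INT dense_interior_in_imp_residual_in) auto
    moreover have "B \<noteq> {}" using M_ne p_onto by auto
    ultimately have "(\<Inter>i. B - (f ^^ i) -` Q) \<inter> B \<noteq> {}"
      by (intro residual_in_compact_meets_open[OF compact_B]) auto
    then show False using hit by blast
  qed
  then obtain i Z where Z: "openin (top_of_set B) Z" "Z \<noteq> {}"
    and Z': "\<And>V. openin (top_of_set B) V \<Longrightarrow> V \<noteq> {} \<Longrightarrow> V \<subseteq> Z \<Longrightarrow> \<not> V \<subseteq> B - (f ^^ i) -` Q"
    unfolding dense_interior_in_def by blast
  have ZB: "Z \<subseteq> B" by (rule openin_imp_subset[OF Z(1)])
  \<comment> \<open>Since \<open>Q\<close> is closed, the part of \<open>Z\<close> outside the
    preimage of \<open>Q\<close> is open, and by the choice of \<open>Z\<close> it cannot be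
    nonempty.\<close>
  have "Z \<subseteq> (f ^^ i) -` Q"
  proof (rule ccontr)
    assume "\<not> Z \<subseteq> (f ^^ i) -` Q"
    moreover have "openin (top_of_set B) (Z - (B \<inter> (f ^^ i) -` Q))"
      using Z(1) closedin_funpow_preimage[OF f_cont f_maps Q] by (rule openin_diff)
    ultimately show False
      using Z'[of "Z - (B \<inter> (f ^^ i) -` Q)"] ZB by blast
  qed
  \<comment> \<open>So far only a preimage of \<open>Q\<close> has interior; feeble openness of
    \<open>f ^^ i\<close> pushes it forward into \<open>Q\<close> itself.\<close>
  moreover obtain V where V: "openin (top_of_set B) V" "V \<noteq> {}" "V \<subseteq> (f ^^ i) ` Z"
    using irreducible_map_feebly_open[OF compact_B continuous_on_funpow[OF f_cont f_maps] irreducible_f] Z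
    unfolding feebly_open_def by blast
  moreover have "Q \<subseteq> p ` U" using e by (auto simp: Q_def)
  ultimately show "\<exists>V. openin (top_of_set B) V \<and> V \<noteq> {} \<and> V \<subseteq> p ` U"
    by (intro exI[of _ V]) blast
qed

text \<open>Feeble openness of \<open>p\<close> only shows that generic fibres meet each
  \<open>G n\<close> inside \<open>V\<close>, possibly at different points for different
  \<open>n\<close>. If there is only one point in \<open>V\<close>, it lies in all
  \<open>G n\<close>, hence in \<open>T\<close>.\<close>

lemma residual_in_singleton_section:
  assumes W: "openin (top_of_set B) W" and V: "open V"
    and sing: "residual_in (top_of_set B) {b \<in> B. b \<in> W \<longrightarrow> (\<forall>x\<in>fibre p M b \<inter> V. \<forall>y\<in>fibre p M b \<inter> V. x = y)}"
    and T: "residual_in (top_of_set M) T"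
  shows "residual_in (top_of_set B) {b \<in> B. b \<in> W \<longrightarrow> fibre p M b \<inter> V \<subseteq> T}"
proof -
  obtain G :: "nat \<Rightarrow> 'e set" where G: "\<And>n. dense_interior_in (top_of_set M) (G n)" "M \<inter> (\<Inter>n. G n) \<subseteq> T"
    using T unfolding residual_in_iff_dense_interiors by auto
  define H where "H n = {b \<in> B. b \<in> W \<longrightarrow> fibre p M b \<inter> V = {} \<or> fibre p M b \<inter> V \<inter> G n \<noteq> {}}" for n
  have "dense_interior_in (top_of_set B) (H n)" for n
  proof (rule dense_interior_inI)
    fix Z assume Z: "openin (top_of_set B) Z" "Z \<noteq> {}"
    have ZB: "Z \<subseteq> B" by (rule openin_imp_subset[OF Z(1)])
    show "\<exists>Z'. openin (top_of_set B) Z' \<and> Z' \<noteq> {} \<and> Z' \<subseteq> Z \<and> Z' \<subseteq> H n"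
    proof (cases "Z \<inter> W = {}")
      case True
      then have "Z \<subseteq> H n" using ZB by (auto simp: H_def)
      then show ?thesis using Z by blast
    next
      case False
      have ZW: "openin (top_of_set B) (Z \<inter> W)" using Z W by blast
      define U where "U = (M \<inter> p -` (Z \<inter> W)) \<inter> V"
      have U: "openin (top_of_set M) U"
        unfolding U_def using V
        by (intro openin_Int_open continuous_openin_preimage[OF p_cont _ ZW]) (auto simp: p_in)
      show ?thesis
      proof (cases "U = {}")
        case True
        then have "Z \<inter> W \<subseteq> H n" using ZB by (auto simp: H_def U_def fibre_def)
        then show ?thesis using ZW False by (intro exI[of _ "Z \<inter> W"]) auto
      next
        case Une: False
        obtain U' where U': "openin (top_of_set M) U'" "U' \<noteq> {}" "U' \<subseteq> U" "U' \<subseteq> G n"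
          by (rule dense_interior_inE[OF G(1) U Une])
        obtain Z' where Z': "openin (top_of_set B) Z'" "Z' \<noteq> {}" "Z' \<subseteq> p ` U'"
          using feebly_open_p U'(1,2) unfolding feebly_open_def by blast
        have "Z' \<subseteq> Z" using Z'(3) U'(3) by (auto simp: U_def)
        moreover have "Z' \<subseteq> H n"
        proof
          fix b assume "b \<in> Z'"
          then obtain x where "x \<in> U'" "p x = b" using Z'(3) by blast
          then have "x \<in> fibre p M b \<inter> V \<inter> G n"
            using U'(3,4) by (auto simp: U_def fibre_def)
          moreover have "b \<in> B" using \<open>b \<in> Z'\<close> \<open>Z' \<subseteq> Z\<close> ZB by blast
          ultimately show "b \<in> H n" by (auto simp: H_def)
        qed
        ultimately show ?thesis using Z'(1,2) by blast
      qed
    qed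
  qed
  then have "residual_in (top_of_set B) (\<Inter>n. H n)"
    by (intro residual_in_INT dense_interior_in_imp_residual_in) (auto simp: H_def)
  from residual_in_Int[OF sing this] show ?thesis
  proof (rule residual_in_mono)
    show "{b \<in> B. b \<in> W \<longrightarrow> (\<forall>x\<in>fibre p M b \<inter> V. \<forall>y\<in>fibre p M b \<inter> V. x = y)} \<inter> (\<Inter>n. H n)
       \<subseteq> {b \<in> B. b \<in> W \<longrightarrow> fibre p M b \<inter> V \<subseteq> T}"
    proof
      fix b assume b: "b \<in> {b \<in> B. b \<in> W \<longrightarrow> (\<forall>x\<in>fibre p M b \<inter> V. \<forall>y\<in>fibre p M b \<inter> V. x = y)} \<inter> (\<Inter>n. H n)"
      have "x \<in> T" if bW: "b \<in> W" and x: "x \<in> fibre p M b \<inter> V" for x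
      proof -
        have "x \<in> G n" for n
        proof -
          have "b \<in> H n" using b by blast
          then obtain y where y: "y \<in> fibre p M b \<inter> V" "y \<in> G n"
            using bW x unfolding H_def by blast
          have "x = y" using b bW x y(1) by simp
          then show ?thesis using y(2) by simp
        qed
        moreover have "x \<in> M" using x by (auto simp: fibre_def)
        ultimately show "x \<in> T" using G(2) by blast
      qed
      then show "b \<in> {b \<in> B. b \<in> W \<longrightarrow> fibre p M b \<inter> V \<subseteq> T}"
        using b by blast
    qed
  qed auto
qed

end

text \<open>Pigeonhole: among \<open>k + 1\<close> distinct points two would share a ball whose
  radius is below half their least distance.\<close>

lemma card_le_if_covered_by_small_balls:
  fixes S :: "'a::metric_space set"
  assumes "\<And>m. \<exists>X. finite X \<and> card X \<le> k \<and> S \<subseteq> (\<Union>x\<in>X. ball x (inverse (Suc m)))"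
  shows "finite S \<and> card S \<le> k"
proof (rule ccontr)
  assume no: "\<not> ?thesis"
  have "\<exists>Y\<subseteq>S. finite Y \<and> card Y = Suc k"
  proof (cases "finite S")
    case True
    then have "Suc k \<le> card S" using no by auto
    then show ?thesis using True by (metis obtain_subset_with_card_n)
  next
    case False
    then show ?thesis using infinite_arbitrarily_large by blast
  qed
  then obtain Y where Y: "Y \<subseteq> S" "finite Y" "card Y = Suc k" by blast
  \<comment> \<open>The element 1 keeps \<open>D\<close> nonempty when \<open>Y\<close> is a single
    point, that is for \<open>k = 0\<close>.\<close>
  define D where "D = insert 1 ((\<lambda>(x, y). dist x y) ` {z \<in> Y \<times> Y. fst z \<noteq> snd z})"
  have "finite D" "D \<noteq> {}" using Y(2) by (auto simp: D_def)
  moreover have "\<forall>d\<in>D. d > 0" by (auto simp: D_def)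
  ultimately have "Min D > 0" by simp
  then obtain m where m: "inverse (Suc m) < Min D / 2"
    using reals_Archimedean[of "Min D / 2"] by auto
  obtain X where X: "finite X" "card X \<le> k" "S \<subseteq> (\<Union>x\<in>X. ball x (inverse (Suc m)))"
    using assms by blast
  then have "\<forall>y\<in>Y. \<exists>x\<in>X. y \<in> ball x (inverse (Suc m))" using Y(1) by blast
  then obtain c where c: "\<And>y. y \<in> Y \<Longrightarrow> c y \<in> X \<and> y \<in> ball (c y) (inverse (Suc m))" by metis
  have "card (c ` Y) \<le> card X" using c X(1) by (intro card_mono) auto
  then have "\<not> inj_on c Y" using X(2) Y(3) card_image[of c Y] by auto
  then obtain x y where xy: "x \<in> Y" "y \<in> Y" "c x = c y" "x \<noteq> y" by (auto simp: inj_on_def)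
  have "dist x y < Min D"
    using c[OF xy(1)] c[OF xy(2)] m dist_triangle3[of x y "c x"] xy(3) by auto
  moreover have "dist x y \<in> D"
    using xy by (force simp: D_def)
  ultimately show False using \<open>finite D\<close> Min_le by fastforce
qed

section \<open>Cardinality of generic fibres\<close>

context minimal_extension
begin

lemma fibre_ne: "b \<in> B \<Longrightarrow> fibre p M b \<noteq> {}"
  using p_onto by (auto simp: fibre_def)

text \<open>Upgrades density in \<open>W\<close> to residuality: close to a fibre with at most
  \<open>k\<close> points, all fibres are covered by \<open>k\<close> balls of a given radius, by
  upper semicontinuity. Intersecting over the radii restores the bound on the cardinality.\<close>

lemma residual_in_card_fibre_le:
  assumes W: "openin (top_of_set B) W"
    and dense: "\<And>Z. openin (top_of_set B) Z \<Longrightarrow> Z \<noteq> {} \<Longrightarrow> Z \<subseteq> W \<Longrightarrow>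
      \<exists>b\<in>Z. finite (fibre p M b) \<and> card (fibre p M b) \<le> k"
  shows "residual_in (top_of_set B) {b \<in> B. b \<in> W \<longrightarrow> finite (fibre p M b) \<and> card (fibre p M b) \<le> k}"
proof (rule residual_inI)
  let ?G = "\<lambda>m. {b \<in> B. b \<in> W \<longrightarrow> (\<exists>X. finite X \<and> card X \<le> k \<and> fibre p M b \<subseteq> (\<Union>x\<in>X. ball x (inverse (Suc m))))}"
  fix m
  show "dense_interior_in (top_of_set B) (?G m)"
  proof (rule dense_interior_inI)
    fix Z assume Z: "openin (top_of_set B) Z" "Z \<noteq> {}"
    have ZB: "Z \<subseteq> B" by (rule openin_imp_subset[OF Z(1)])
    show "\<exists>Z'. openin (top_of_set B) Z' \<and> Z' \<noteq> {} \<and> Z' \<subseteq> Z \<and> Z' \<subseteq> ?G m"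
    proof (cases "Z \<inter> W = {}")
      case True
      then have "Z \<subseteq> ?G m" using ZB by auto
      then show ?thesis using Z by blast
    next
      case False
      have ZW: "openin (top_of_set B) (Z \<inter> W)" using Z W by blast
      then obtain b where b: "b \<in> Z \<inter> W" "finite (fibre p M b)" "card (fibre p M b) \<le> k"
        using dense[OF ZW False] by auto
      let ?V = "\<Union>x\<in>fibre p M b. ball x (inverse (Suc m))"
      let ?Z = "Z \<inter> W \<inter> {b' \<in> B. fibre p M b' \<subseteq> M \<inter> ?V}"
      have "openin (top_of_set B) {b' \<in> B. fibre p M b' \<subseteq> M \<inter> ?V}"
        by (rule openin_fibre_tube) (auto intro: openin_open_Int)
      then have "openin (top_of_set B) ?Z" using ZW by blast
      moreover have "fibre p M b \<subseteq> M \<inter> ?V"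
        by (auto simp: fibre_def)
      then have "b \<in> ?Z" using b(1) ZB by blast
      moreover have "?Z \<subseteq> ?G m" using b(2,3) by blast
      ultimately show ?thesis by (intro exI[of _ ?Z]) blast
    qed
  qed
next
  fix b assume b: "b \<in> topspace (top_of_set B)"
    "\<And>m. b \<in> {b \<in> B. b \<in> W \<longrightarrow> (\<exists>X. finite X \<and> card X \<le> k \<and> fibre p M b \<subseteq> (\<Union>x\<in>X. ball x (inverse (Suc m))))}"
  have "finite (fibre p M b) \<and> card (fibre p M b) \<le> k" if "b \<in> W"
    by (rule card_le_if_covered_by_small_balls) (use b(2) that in blast)
  then show "b \<in> {b \<in> B. b \<in> W \<longrightarrow> finite (fibre p M b) \<and> card (fibre p M b) \<le> k}"
    using b(1) by auto
qed auto

text \<open>Where \<open>f\<^sup>i\<close> is injective over \<open>f\<^sup>i b\<close>, the fibre over \<open>f\<^sup>i b\<close> is the \<open>F\<^sup>i\<close>-image of the fibre over \<open>b\<close>;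
  this transports the least locally generic cardinality from one open set to all others.\<close>

lemma generic_card_fibre_constant:
  assumes bounded: "residual_in (top_of_set B) {b \<in> B. finite (fibre p M b) \<and> card (fibre p M b) \<le> n}"
  shows "\<exists>N>0. residual_in (top_of_set B) {b \<in> B. finite (fibre p M b) \<and> card (fibre p M b) = N}"
proof -
  define A where "A k = {b \<in> B. finite (fibre p M b) \<and> card (fibre p M b) \<le> k}" for k
  \<comment> \<open>Density in one open set is all that is needed to get residuality there, and its
    failure is nowhere density; hence taking the least \<open>k\<close> gives both bounds.\<close>
  define somewhere where "somewhere k \<longleftrightarrow> (\<exists>W. openin (top_of_set B) W \<and> W \<noteq> {} \<and>
      (\<forall>Z. openin (top_of_set B) Z \<and> Z \<noteq> {} \<and> Z \<subseteq> W \<longrightarrow> A k \<inter> Z \<noteq> {}))" for k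
  define N where "N = (LEAST k. somewhere k)"
  have B_ne: "B \<noteq> {}" using M_ne p_onto by auto
  have "somewhere n"
    unfolding somewhere_def
  proof (intro exI[of _ B] conjI allI impI)
    fix Z assume "openin (top_of_set B) Z \<and> Z \<noteq> {} \<and> Z \<subseteq> B"
    then show "A n \<inter> Z \<noteq> {}"
      using residual_in_compact_meets_open[OF compact_B bounded] by (auto simp: A_def)
  qed (use B_ne in auto)
  then have "somewhere N" unfolding N_def by (rule LeastI)
  then obtain W where W: "openin (top_of_set B) W" "W \<noteq> {}"
    and dW: "\<And>Z. openin (top_of_set B) Z \<Longrightarrow> Z \<noteq> {} \<Longrightarrow> Z \<subseteq> W \<Longrightarrow> A N \<inter> Z \<noteq> {}"
    unfolding somewhere_def by blast
  have resW: "residual_in (top_of_set B) {b \<in> B. b \<in> W \<longrightarrow> finite (fibre p M b) \<and> card (fibre p M b) \<le> N}"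
  proof (rule residual_in_card_fibre_le[OF W(1)])
    fix Z assume "openin (top_of_set B) Z" "Z \<noteq> {}" "Z \<subseteq> W"
    from dW[OF this] show "\<exists>b\<in>Z. finite (fibre p M b) \<and> card (fibre p M b) \<le> N"
      by (auto simp: A_def)
  qed
  have "residual_in (top_of_set B) {b \<in> B. b \<in> B \<longrightarrow> finite (fibre p M b) \<and> card (fibre p M b) \<le> N}"
  proof (rule residual_in_card_fibre_le)
    fix Z assume Z: "openin (top_of_set B) Z" "Z \<noteq> {}"
    obtain b0 where b0: "b0 \<in> W" using W(2) by blast
    have "b0 \<in> B" using b0 openin_imp_subset[OF W(1)] by blast
    then obtain i where i: "(f ^^ i) b0 \<in> Z"
      using minimal_map_orbit_meets_open[OF compact_B f_cont f_min Z] by blast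
    have "openin (top_of_set B) (W \<inter> (B \<inter> (f ^^ i) -` Z))"
      using W(1) openin_funpow_preimage[OF f_cont f_maps Z(1)] by (rule openin_Int)
    moreover have "W \<inter> (B \<inter> (f ^^ i) -` Z) \<noteq> {}"
      using b0 i \<open>b0 \<in> B\<close> by blast
    ultimately obtain b where b: "b \<in> W" "b \<in> B" "(f ^^ i) b \<in> Z"
      "finite (fibre p M b)" "card (fibre p M b) \<le> N" "\<forall>b'\<in>B. (f ^^ i) b' = (f ^^ i) b \<longrightarrow> b' = b"
      using residual_in_compact_meets_open[OF compact_B residual_in_Int[OF resW residual_in_f_injective[of i]]]
      by blast
    have "fibre p M ((f ^^ i) b) \<subseteq> (F ^^ i) ` fibre p M b"
    proof
      fix y assume "y \<in> fibre p M ((f ^^ i) b)"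
      then have y: "y \<in> M" "p y = (f ^^ i) b" by (auto simp: fibre_def)
      have "y \<in> (F ^^ i) ` M"
        using irreducible_map_imp_onto[OF irreducible_F[of i]] y(1) by simp
      then obtain x where x: "x \<in> M" "(F ^^ i) x = y" by blast
      then have "p x = b"
        using b(6) p_in[OF x(1)] semiconj_funpow[OF x(1), of i] y(2) by auto
      then show "y \<in> (F ^^ i) ` fibre p M b" using x by (auto simp: fibre_def)
    qed
    then have "finite (fibre p M ((f ^^ i) b))" "card (fibre p M ((f ^^ i) b)) \<le> card (fibre p M b)"
      using b(4) by (auto intro: finite_subset surj_card_le)
    then show "\<exists>b\<in>Z. finite (fibre p M b) \<and> card (fibre p M b) \<le> N"
      using b(3,5) by (intro bexI[of _ "(f ^^ i) b"]) auto
  qed auto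
  then have resN: "residual_in (top_of_set B) (A N)"
    by (rule residual_in_mono) (auto simp: A_def)
  have "A 0 = {}" using fibre_ne by (fastforce simp: A_def)
  have "N \<noteq> 0"
  proof
    assume "N = 0"
    then show False using \<open>A 0 = {}\<close> dW[OF W order_refl] by auto
  qed
  then obtain k where k: "N = Suc k" using not0_implies_Suc by blast
  have "\<not> somewhere k"
    using not_less_Least[of k somewhere] k by (auto simp: N_def)
  \<comment> \<open>By leastness of \<open>N\<close>, fibres with at most \<open>N - 1\<close>
    points are negligible, which turns the upper bound \<open>N\<close> into equality.\<close>
  then have "dense_interior_in (top_of_set B) (B - A k)"
  proof (intro dense_interior_inI)
    fix W assume W: "openin (top_of_set B) W" "W \<noteq> {}"
    with \<open>\<not> somewhere k\<close> obtain Z where Z: "openin (top_of_set B) Z" "Z \<noteq> {}" "Z \<subseteq> W" "A k \<inter> Z = {}"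
      unfolding somewhere_def by blast
    moreover have "Z \<subseteq> B" by (rule openin_imp_subset[OF Z(1)])
    ultimately show "\<exists>V. openin (top_of_set B) V \<and> V \<noteq> {} \<and> V \<subseteq> W \<and> V \<subseteq> B - A k"
      by (intro exI[of _ Z]) blast
  qed
  then have "residual_in (top_of_set B) (B - A k)"
    by (rule dense_interior_in_imp_residual_in) auto
  from residual_in_Int[OF resN this]
  have "residual_in (top_of_set B) {b \<in> B. finite (fibre p M b) \<and> card (fibre p M b) = N}"
    by (rule residual_in_mono) (auto simp: A_def k)
  then show ?thesis using \<open>N \<noteq> 0\<close> by blast
qed

text \<open>If isolated points occur over a nonmeagre set, then some neighbourhood \<open>V\<close> meets the generic fibre over
  some open \<open>W\<close> in at most one point, which moreover has only one preimage under every iterate of \<open>F\<close>. Since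
  every orbit in \<open>M\<close> visits this piece within \<open>n\<close> steps, the visiting time is injective on generic fibres.\<close>

lemma generic_fibre_bounded_if_isolated_points:
  assumes "\<not> residual_in (top_of_set B) {b \<in> B. \<forall>x\<in>fibre p M b. x islimpt fibre p M b}"
  obtains n where "residual_in (top_of_set B) {b \<in> B. finite (fibre p M b) \<and> card (fibre p M b) \<le> n}"
proof -
  obtain \<V> where \<V>: "countable \<V>" "\<And>V. V \<in> \<V> \<Longrightarrow> open V"
    "\<And>x T. x \<in> M \<Longrightarrow> open T \<Longrightarrow> x \<in> T \<Longrightarrow> \<exists>V\<in>\<V>. x \<in> V \<and> closure V \<subseteq> T"
    using compact_countable_base[OF compact_M] by metis
  \<comment> \<open>Every isolated point of a fibre is caught by some \<open>V\<close> of the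
    countable base, so nonmeagreness singles out one \<open>V\<close>. Uniqueness in
    \<open>closure V\<close> is used because the complement of \<open>closure V\<close> is open, as
    upper semicontinuity requires.\<close>
  define P where "P V b \<longleftrightarrow> (\<exists>x. fibre p M b \<inter> closure V = {x} \<and> x \<in> V)" for V b
  have "\<exists>V\<in>\<V>. \<not> dense_interior_in (top_of_set B) {b \<in> B. \<not> P V b}"
  proof (rule ccontr)
    assume "\<not> ?thesis"
    then have "residual_in (top_of_set B) (topspace (top_of_set B) \<inter> (\<Inter>V\<in>\<V>. {b \<in> B. \<not> P V b}))"
      by (intro residual_in_INT_countable \<V>(1) dense_interior_in_imp_residual_in) auto
    then have "residual_in (top_of_set B) {b \<in> B. \<forall>x\<in>fibre p M b. x islimpt fibre p M b}"
    proof (rule residual_in_mono)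
      show "topspace (top_of_set B) \<inter> (\<Inter>V\<in>\<V>. {b \<in> B. \<not> P V b})
          \<subseteq> {b \<in> B. \<forall>x\<in>fibre p M b. x islimpt fibre p M b}"
      proof (clarsimp, rule ccontr)
        fix b x assume b: "b \<in> B" "\<forall>V\<in>\<V>. \<not> P V b" and x: "x \<in> fibre p M b"
          and "\<not> x islimpt fibre p M b"
        then obtain T where T: "open T" "x \<in> T" "\<And>y. y \<in> fibre p M b \<Longrightarrow> y \<in> T \<Longrightarrow> y = x"
          unfolding islimpt_def by blast
        have "x \<in> M" using x by (auto simp: fibre_def)
        then obtain V where V: "V \<in> \<V>" "x \<in> V" "closure V \<subseteq> T" using \<V>(3) T(1,2) by blast
        have "x \<in> closure V" using V(2) closure_subset[of V] by blast
        then have "fibre p M b \<inter> closure V = {x}" using V(3) T(3) x by blast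
        then have "P V b" using V(2) by (auto simp: P_def)
        then show False using b(2) V(1) by blast
      qed
    qed auto
    then show False using assms by blast
  qed
  then obtain V W where V: "V \<in> \<V>" and W: "openin (top_of_set B) W" "W \<noteq> {}"
    and nd: "\<And>Z. openin (top_of_set B) Z \<Longrightarrow> Z \<noteq> {} \<Longrightarrow> Z \<subseteq> W \<Longrightarrow> \<not> Z \<subseteq> {b \<in> B. \<not> P V b}"
    unfolding dense_interior_in_def by blast
  have oV: "open V" using V \<V>(2) by blast
  have dense: "\<exists>b\<in>Z. P V b" if "openin (top_of_set B) Z" "Z \<noteq> {}" "Z \<subseteq> W" for Z
    using nd[OF that] openin_imp_subset[OF that(1)] by blast
  \<comment> \<open>\<open>closure V \<inter> - V\<close> is the frontier of the open
    \<open>V\<close>; avoiding it is an open condition on the fibre, and \<open>b1\<close> below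
    witnesses that it can be met.\<close>
  define W1 where "W1 = W \<inter> {b \<in> B. fibre p M b \<subseteq> M \<inter> - (closure V \<inter> - V)}"
  have "open (- (closure V \<inter> - V))" using oV by (intro open_Compl closed_Int) auto
  then have W1: "openin (top_of_set B) W1"
    unfolding W1_def by (intro openin_Int W(1) openin_fibre_tube openin_open_Int)
  have W1_sub: "W1 \<subseteq> W" "W1 \<subseteq> B" by (auto simp: W1_def)
  have W1D: "x \<in> V" if "b \<in> W1" "x \<in> fibre p M b" "x \<in> closure V" for b x
    using that by (auto simp: W1_def)
  obtain b1 x1 where b1: "b1 \<in> W" "fibre p M b1 \<inter> closure V = {x1}" "x1 \<in> V"
    using dense[OF W order_refl] by (auto simp: P_def)
  have b1W1: "b1 \<in> W1"
  proof -
    have "b1 \<in> B" using b1(1) openin_imp_subset[OF W(1)] by blast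
    moreover have "fibre p M b1 \<subseteq> M" by (auto simp: fibre_def)
    moreover have "x \<notin> closure V \<inter> - V" if "x \<in> fibre p M b1" for x
      using that b1(2,3) by auto
    ultimately show ?thesis using b1(1) unfolding W1_def by blast
  qed
  define Sing where "Sing = {b \<in> B. b \<in> W1 \<longrightarrow> (\<forall>x\<in>fibre p M b \<inter> V. \<forall>y\<in>fibre p M b \<inter> V. x = y)}"
  have sing: "residual_in (top_of_set B) Sing"
  proof (rule residual_inI)
    let ?G = "\<lambda>m. {b \<in> B. b \<in> W1 \<longrightarrow> (\<forall>x\<in>fibre p M b \<inter> V. \<forall>y\<in>fibre p M b \<inter> V. dist x y < inverse (Suc m))}"
    fix m
    show "dense_interior_in (top_of_set B) (?G m)"
    proof (rule dense_interior_inI)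
      fix Z assume Z: "openin (top_of_set B) Z" "Z \<noteq> {}"
      have ZB: "Z \<subseteq> B" by (rule openin_imp_subset[OF Z(1)])
      show "\<exists>Z'. openin (top_of_set B) Z' \<and> Z' \<noteq> {} \<and> Z' \<subseteq> Z \<and> Z' \<subseteq> ?G m"
      proof (cases "Z \<inter> W1 = {}")
        case True
        then have "Z \<subseteq> ?G m" using ZB by auto
        then show ?thesis using Z by blast
      next
        case False
        have ZW: "openin (top_of_set B) (Z \<inter> W1)" using Z W1 by blast
        then obtain b x where b: "b \<in> Z \<inter> W1" "fibre p M b \<inter> closure V = {x}"
          using dense[OF ZW False] W1_sub(1) by (auto simp: P_def)
        define r where "r = inverse (real (Suc m)) / 2"
        have r: "r > 0" by (simp add: r_def)
        \<comment> \<open>The fibre over \<open>b\<close> lies in this open set, since its only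
          point in \<open>closure V\<close> is \<open>x\<close>. Nearby fibres then have their part
          in \<open>V\<close> within \<open>ball x r\<close>, hence of diameter below twice
          \<open>r\<close>.\<close>
        define U where "U = M \<inter> (- closure V \<union> ball x r)"
        let ?Z = "Z \<inter> W1 \<inter> {b' \<in> B. fibre p M b' \<subseteq> U}"
        have "openin (top_of_set M) U"
          unfolding U_def by (intro openin_open_Int open_Un open_Compl) auto
        then have "openin (top_of_set B) ?Z"
          using ZW openin_fibre_tube by blast
        moreover have "fibre p M b \<subseteq> U"
        proof
          fix y assume y: "y \<in> fibre p M b"
          then have "y \<in> closure V \<Longrightarrow> y = x" using b(2) by blast
          then show "y \<in> U" using y r by (auto simp: U_def fibre_def)
        qed
        then have "b \<in> ?Z" using b(1) ZB by blast
        moreover have "?Z \<subseteq> ?G m"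
        proof
          fix b' assume b': "b' \<in> ?Z"
          have near: "dist x y < r" if "y \<in> fibre p M b' \<inter> V" for y
            using that b' closure_subset[of V] by (auto simp: U_def)
          have "dist y z < inverse (Suc m)" if "y \<in> fibre p M b' \<inter> V" "z \<in> fibre p M b' \<inter> V" for y z
            using near[OF that(1)] near[OF that(2)] dist_triangle3[of y z x] by (simp add: r_def)
          then show "b' \<in> ?G m" using b' by blast
        qed
        ultimately show ?thesis by (intro exI[of _ ?Z]) blast
      qed
    qed
  next
    fix b assume b: "b \<in> topspace (top_of_set B)"
      "\<And>m. b \<in> {b \<in> B. b \<in> W1 \<longrightarrow> (\<forall>x\<in>fibre p M b \<inter> V. \<forall>y\<in>fibre p M b \<inter> V. dist x y < inverse (Suc m))}"
    have "x = y" if xy: "b \<in> W1" "x \<in> fibre p M b \<inter> V" "y \<in> fibre p M b \<inter> V" for x y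
    proof (rule ccontr)
      assume "x \<noteq> y"
      then obtain m where "inverse (Suc m) < dist x y"
        using reals_Archimedean[of "dist x y"] by auto
      moreover have "dist x y < inverse (Suc m)" using b(2)[of m] xy by simp
      ultimately show False by simp
    qed
    then show "b \<in> Sing" using b(1) by (auto simp: Sing_def)
  qed (auto simp: Sing_def)
  define T where "T = (\<Inter>i. {y \<in> M. \<forall>x\<in>M. \<forall>x'\<in>M. (F ^^ i) x = y \<and> (F ^^ i) x' = y \<longrightarrow> x = x'})"
  have "residual_in (top_of_set M) T"
    unfolding T_def
    by (intro residual_in_INT irreducible_map_residual_singleton_fibres compact_M
        continuous_on_funpow F_cont F_maps irreducible_F)
  then have "residual_in (top_of_set B) {b \<in> B. b \<in> W1 \<longrightarrow> fibre p M b \<inter> V \<subseteq> T}"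
    by (rule residual_in_singleton_section[OF W1 oV sing[unfolded Sing_def]])
  \<comment> \<open>All iterates are treated at once, because the visiting time varies over the
    points of one fibre.\<close>
  then have "residual_in (top_of_set B) (\<Inter>i. {b \<in> B. (f ^^ i) b \<in> Sing \<inter> {b \<in> B. b \<in> W1 \<longrightarrow> fibre p M b \<inter> V \<subseteq> T}})"
    by (intro residual_in_INT residual_in_f_preimage residual_in_Int sing)
  moreover
  define O' where "O' = (M \<inter> p -` W1) \<inter> V"
  have "openin (top_of_set M) O'"
    unfolding O'_def using oV
    by (intro openin_Int_open continuous_openin_preimage[OF p_cont _ W1]) (auto simp: p_in)
  moreover have "x1 \<in> O'"
    using b1(2,3) b1W1 by (auto simp: O'_def fibre_def)
  ultimately obtain n where n: "\<And>x. x \<in> M \<Longrightarrow> \<exists>i<n. (F ^^ i) x \<in> O'"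
    using minimal_map_uniform_hitting_time[OF compact_M F_cont F_min] by blast
  obtain \<tau> where \<tau>: "\<And>x. x \<in> M \<Longrightarrow> \<tau> x < n \<and> (F ^^ \<tau> x) x \<in> O'"
    using n by metis
  have "residual_in (top_of_set B) {b \<in> B. finite (fibre p M b) \<and> card (fibre p M b) \<le> n}"
    using \<open>residual_in (top_of_set B) (\<Inter>i. {b \<in> B. (f ^^ i) b \<in> Sing \<inter> {b \<in> B. b \<in> W1 \<longrightarrow> fibre p M b \<inter> V \<subseteq> T}})\<close>
  proof (rule residual_in_mono)
    show "(\<Inter>i. {b \<in> B. (f ^^ i) b \<in> Sing \<inter> {b \<in> B. b \<in> W1 \<longrightarrow> fibre p M b \<inter> V \<subseteq> T}})
       \<subseteq> {b \<in> B. finite (fibre p M b) \<and> card (fibre p M b) \<le> n}"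
    proof
      fix b assume b: "b \<in> (\<Inter>i. {b \<in> B. (f ^^ i) b \<in> Sing \<inter> {b \<in> B. b \<in> W1 \<longrightarrow> fibre p M b \<inter> V \<subseteq> T}})"
      have inj: "inj_on \<tau> (fibre p M b)"
      proof (rule inj_onI)
        fix x y assume xy: "x \<in> fibre p M b" "y \<in> fibre p M b" "\<tau> x = \<tau> y"
        define i where "i = \<tau> x"
        have M: "x \<in> M" "y \<in> M" and px: "p x = b" "p y = b" using xy by (auto simp: fibre_def)
        have O': "(F ^^ i) x \<in> O'" "(F ^^ i) y \<in> O'"
          using \<tau>[OF M(1)] \<tau>[OF M(2)] xy(3) by (auto simp: i_def)
        have fb: "p ((F ^^ i) x) = (f ^^ i) b" "p ((F ^^ i) y) = (f ^^ i) b"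
          using semiconj_funpow M px by auto
        have bi: "(f ^^ i) b \<in> Sing" "(f ^^ i) b \<in> W1 \<longrightarrow> fibre p M ((f ^^ i) b) \<inter> V \<subseteq> T"
          using b by auto
        have W1b: "(f ^^ i) b \<in> W1" and "(F ^^ i) x \<in> fibre p M ((f ^^ i) b) \<inter> V"
          and "(F ^^ i) y \<in> fibre p M ((f ^^ i) b) \<inter> V"
          using O' fb by (auto simp: O'_def fibre_def)
        \<comment> \<open>Both images lie in \<open>V\<close> over the same base point in
          \<open>W1\<close>, so \<open>Sing\<close> identifies them; membership in \<open>T\<close>
          then leaves a single preimage under \<open>F ^^ i\<close>.\<close>
        then have "(F ^^ i) x = (F ^^ i) y" "(F ^^ i) x \<in> T"
          using bi unfolding Sing_def by auto
        then show "x = y" using M unfolding T_def by auto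
      qed
      have sub: "\<tau> ` fibre p M b \<subseteq> {..<n}"
        using \<tau> by (auto simp: fibre_def)
      have "finite (fibre p M b)"
        using inj sub by (meson finite_lessThan inj_on_finite)
      moreover have "card (fibre p M b) \<le> n"
        using card_inj_on_le[OF inj sub] by simp
      moreover have "b \<in> B" using b by auto
      ultimately show "b \<in> {b \<in> B. finite (fibre p M b) \<and> card (fibre p M b) \<le> n}" by blast
    qed
  qed auto
  then show thesis by (rule that)
qed

end

theorem theoremE:
  fixes E :: "'e::metric_space set" and B :: "'b::metric_space set"
    and \<Gamma> :: "'g::metric_space set"
    and p :: "'e \<Rightarrow> 'b" and F :: "'e \<Rightarrow> 'e" and f :: "'b \<Rightarrow> 'b" and M :: "'e set"
  assumes graph_bdl: "compact_graph_bundle E B p \<Gamma>"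
    and F_cont: "continuous_on E F" and F_maps: "F ` E \<subseteq> E"
    and f_cont: "continuous_on B f" and f_maps: "f ` B \<subseteq> B"
    and semiconj: "\<forall>x\<in>E. p (F x) = f (p x)"
    and f_minimal: "minimal_map B f"
    and M_minimal: "minimal_set E F M"
    and M_onto: "p ` M = B"
    and M_nowhere_dense: "nowhere_dense_in (top_of_set E) M"
  shows "(\<exists>R. residual_in (top_of_set B) R \<and> (\<forall>b\<in>R. cantor_set (fibre p M b)))
       \<or> (\<exists>N::nat. N > 0 \<and> (\<exists>R. residual_in (top_of_set B) R \<and>
            (\<forall>b\<in>R. finite (fibre p M b) \<and> card (fibre p M b) = N)))"
proof -
  have E: "compact E" "compact B" "continuous_on E p"
    using graph_bdl by (auto simp: compact_graph_bundle_def)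
  have M: "M \<noteq> {}" "M \<subseteq> E" "closedin (top_of_set E) M" "minimal_map M F"
    using M_minimal by (auto simp: minimal_set_def)
  have cM: "compact M" by (rule closedin_compact[OF E(1) M(3)])
  interpret minimal_extension M B p F f
    using cM E M F_cont f_cont semiconj f_minimal M_onto
    by unfold_locales (auto intro: continuous_on_subset)
  let ?R = "{b \<in> B. \<forall>x\<in>fibre p M b. x islimpt fibre p M b}"
  show ?thesis
  proof (cases "residual_in (top_of_set B) ?R")
    case True
    let ?S = "{b \<in> B. \<forall>S. S \<subseteq> fibre p M b \<and> connected S \<longrightarrow> (\<exists>a. S \<subseteq> {a})}"
    have "residual_in (top_of_set B) (?R \<inter> ?S)"
      using residual_in_Int[OF True bundle_generic_fibre_totally_disconnected[OF graph_bdl M(3) M_nowhere_dense]] .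
    moreover have "cantor_set (fibre p M b)" if b: "b \<in> ?R \<inter> ?S" for b
    proof (rule perfect_totally_disconnected_compact_imp_cantor_set)
      have "closedin (top_of_set M) (M \<inter> p -` {b})"
        by (rule continuous_closedin_preimage[OF p_cont]) simp
      then show "compact (fibre p M b)"
        unfolding fibre_def by (rule closedin_compact[OF cM])
      show "fibre p M b \<noteq> {}" using b by (intro fibre_ne) auto
    qed (use b in auto)
    ultimately show ?thesis by blast
  next
    case False
    then obtain n where "residual_in (top_of_set B) {b \<in> B. finite (fibre p M b) \<and> card (fibre p M b) \<le> n}"
      by (rule generic_fibre_bounded_if_isolated_points)
    then obtain N where "N > 0" "residual_in (top_of_set B) {b \<in> B. finite (fibre p M b) \<and> card (fibre p M b) = N}"
      using generic_card_fibre_constant by blast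
    then show ?thesis by blast
  qed
qed

end
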